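(* Let $r\ge1$, let $m=(m_{i,j})_{1\le i<j\le r+1}$ be positive integers, $M=\sum_{1\le i<j\le r+1}m_{i,j}$, and $\partial_i=\partial/\partial a_i$. Let $\phi_r=\phi(a_1,\dots,a_r)$ be a homogeneous polynomial of degree $d$ satisfying, for each $l=1,\dots,r$, $$\Big(\prod_{j=l+1}^{r}(\partial_l-\partial_j)^{m_{l,j}}\Big)\partial_l^{m_{l,r+1}}\phi_r=0$$ (that is, $\partial_r^{m_{r,r+1}}\phi_r=0$, $(\partial_{r-1}-\partial_r)^{m_{r-1,r}}\partial_{r-1}^{m_{r-1,r+1}}\phi_r=0$, \dots, $(\partial_1-\partial_2)^{m_{1,2}}\cdots(\partial_1-\partial_r)^{m_{1,r}}\partial_1^{m_{1,r+1}}\phi_r=0$). Then: (1) if $M-r<d$, then $\phi_r=0$; (2) if $0\le d\le M-r$, then there exists a nonzero homogeneous polynomial $\phi_r$ of degree $d$ satisfying this system; (3) if $d=M-r$, then $\phi_r$ is a constant multiple of $v_{A_r^+,m,\mathfrak{c}_{\rm nice}}(a)$.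
   Context: Let $e_1,\dots,e_{r+1}$ be the standard basis of $\mathbb{R}^{r+1}$, $V=\{a:\sum a_i=0\}$, $A_r^+=\{e_i-e_j:i<j\}$. For $a=\sum_{i=1}^r a_i(e_i-e_{r+1})$ with $a_i\ge0$, the flow polytope is $P_{A_r^+,m}(a)=\{(y_{i,j,k})\in\mathbb{R}^M: 1\le k\le m_{i,j},\ y_{i,j,k}\ge0,\ \sum_{i<j}\sum_{k}y_{i,j,k}(e_i-e_j)=a\}$, with volume taken with respect to the quotient measure $du/da$ on the fibre of $\varphi:\mathbb{R}^M\to V$ (coordinate $y_{i,j,k}\mapsto e_i-e_j$), $du$ Lebesgue measure on $\mathbb{R}^M$, $da$ the Lebesgue measure on $V$ normalized by the lattice generated by $A_r^+$. The nice chamber is $\mathfrak{c}_{\rm nice}=\{\sum_{i=1}^r a_i(e_i-e_{r+1}):a_i>0\}$, and $v_{A_r^+,m,\mathfrak{c}_{\rm nice}}(a)$ is the homogeneous polynomial of degree $M-r$ in $a_1,\dots,a_r$ coinciding with the volume of $P_{A_r^+,m}(a)$ on the closure of $\mathfrak{c}_{\rm nice}$. *)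

theory Defs
  imports "HOL-Analysis.Analysis" "HOL-Library.Poly_Mapping"
begin

section \<open>Real polynomials in the variables \<open>a\<^sub>1, \<dots>, a\<^sub>r\<close>\<close>

text \<open>
  An exponent is a finitely supported map from variable indices to natural numbers; the
  product on \<open>mpoly\<close> is the convolution product of \<^theory>\<open>HOL-Library.Poly_Mapping\<close>.
\<close>

type_synonym mpoly = "(nat \<Rightarrow>\<^sub>0 nat) \<Rightarrow>\<^sub>0 real"

definition exp_degree :: "(nat \<Rightarrow>\<^sub>0 nat) \<Rightarrow> nat" where
  "exp_degree \<alpha> = (\<Sum>i\<in>Poly_Mapping.keys \<alpha>. Poly_Mapping.lookup \<alpha> i)"

text \<open>As usual, the zero polynomial is homogeneous of every degree.\<close>

definition homogeneous :: "nat \<Rightarrow> nat \<Rightarrow> mpoly \<Rightarrow> bool" where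
  "homogeneous r d p \<longleftrightarrow>
     (\<forall>\<alpha>\<in>Poly_Mapping.keys p. Poly_Mapping.keys \<alpha> \<subseteq> {1..r} \<and> exp_degree \<alpha> = d)"

definition eval_mpoly :: "(nat \<Rightarrow> real) \<Rightarrow> mpoly \<Rightarrow> real" where
  "eval_mpoly x p =
     (\<Sum>\<alpha>\<in>Poly_Mapping.keys p. Poly_Mapping.lookup p \<alpha> *
        (\<Prod>i\<in>Poly_Mapping.keys \<alpha>. x i ^ Poly_Mapping.lookup \<alpha> i))"

definition const_mpoly :: "real \<Rightarrow> mpoly" where
  "const_mpoly c = Poly_Mapping.single 0 c"

text \<open>
  The subtraction of exponents truncates only where the coefficient \<open>\<alpha>\<^sub>i\<close> vanishes.
\<close>

definition partial :: "nat \<Rightarrow> mpoly \<Rightarrow> mpoly" where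
  "partial i p =
     (\<Sum>\<alpha>\<in>Poly_Mapping.keys p. Poly_Mapping.single (\<alpha> - Poly_Mapping.single i 1)
        (of_nat (Poly_Mapping.lookup \<alpha> i) * Poly_Mapping.lookup p \<alpha>))"

lemma lookup_partial:
  "Poly_Mapping.lookup (partial i p) \<beta> =
     of_nat (Poly_Mapping.lookup \<beta> i + 1) * Poly_Mapping.lookup p (\<beta> + Poly_Mapping.single i 1)"
proof -
  let ?e = "Poly_Mapping.single i (1::nat)"
  have eq: "Poly_Mapping.lookup
          (Poly_Mapping.single (\<alpha> - ?e) (of_nat (Poly_Mapping.lookup \<alpha> i) * Poly_Mapping.lookup p \<alpha>)) \<beta>
        = (if \<alpha> = \<beta> + ?e then of_nat (Poly_Mapping.lookup \<beta> i + 1) * Poly_Mapping.lookup p (\<beta> + ?e) else 0)"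
    for \<alpha>
  proof (cases "Poly_Mapping.lookup \<alpha> i = 0")
    case True
    then have "\<alpha> \<noteq> \<beta> + ?e" by (auto simp: lookup_add)
    with True show ?thesis by (simp add: lookup_single when_def)
  next
    case False
    then have "\<alpha> - ?e + ?e = \<alpha>"
      by (intro poly_mapping_eqI) (auto simp: lookup_add lookup_minus lookup_single when_def)
    then have "\<alpha> - ?e = \<beta> \<longleftrightarrow> \<alpha> = \<beta> + ?e" by auto
    then show ?thesis by (auto simp: lookup_single when_def lookup_add)
  qed
  show ?thesis
    unfolding partial_def lookup_sum eq
    by (auto simp: sum.delta in_keys_iff)
qed


section \<open>The system of differential equations\<close>

definition num_coords :: "nat \<Rightarrow> (nat \<Rightarrow> nat \<Rightarrow> nat) \<Rightarrow> nat" where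
  "num_coords r m = (\<Sum>(i, j)\<in>{(i, j). 1 \<le> i \<and> i < j \<and> j \<le> r + 1}. m i j)"

text \<open>The truncated difference \<open>num_coords r m - r\<close> used below is the true one for positive \<open>m\<close>:\<close>

lemma le_num_coords:
  assumes "\<And>i j. 1 \<le> i \<Longrightarrow> i < j \<Longrightarrow> j \<le> r + 1 \<Longrightarrow> 0 < m i j"
  shows "r \<le> num_coords r m"
proof -
  let ?R = "{(i, j). 1 \<le> i \<and> i < j \<and> j \<le> r + 1}"
  have fin: "finite ?R" by (rule finite_subset[of _ "{0..r+1} \<times> {0..r+1}"]) auto
  have "r = (\<Sum>(i, j)\<in>(\<lambda>i. (i, r+1)) ` {1..r}. 1)"
    by (subst sum.reindex) (auto simp: inj_on_def)
  also have "\<dots> \<le> (\<Sum>(i, j)\<in>?R. 1)"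
    by (rule sum_mono2[OF fin]) auto
  also have "\<dots> \<le> num_coords r m"
    unfolding num_coords_def
  proof (rule sum_mono, clarify)
    fix i j :: nat assume "1 \<le> i" "i < j" "j \<le> r + 1"
    from assms[OF this] show "1 \<le> m i j" by simp
  qed
  finally show ?thesis .
qed

definition flow_operator :: "nat \<Rightarrow> (nat \<Rightarrow> nat \<Rightarrow> nat) \<Rightarrow> nat \<Rightarrow> mpoly \<Rightarrow> mpoly" where
  "flow_operator r m l \<phi> =
     foldr (\<lambda>j. (\<lambda>p. partial l p - partial j p) ^^ m l j) [l + 1..<r + 1]
       ((partial l ^^ m l (r + 1)) \<phi>)"

definition solves_flow_system :: "nat \<Rightarrow> (nat \<Rightarrow> nat \<Rightarrow> nat) \<Rightarrow> mpoly \<Rightarrow> bool" where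
  "solves_flow_system r m \<phi> \<longleftrightarrow> (\<forall>l\<in>{1..r}. flow_operator r m l \<phi> = 0)"


section \<open>The space \<open>V\<close> and its Lebesgue measure\<close>

text \<open>
  Vectors of \<open>\<real>\<^bsup>r+1\<^esup>\<close> are functions supported on the index set \<open>{1..r+1}\<close>
  in the sense of \<^const>\<open>extensional\<close>, that is, points of the product measure space.
\<close>

definition basis_vec :: "nat \<Rightarrow> nat \<Rightarrow> nat \<Rightarrow> real" where
  "basis_vec r i = (\<lambda>v\<in>{1..r+1}. if v = i then 1 else 0)"

definition V_space :: "nat \<Rightarrow> (nat \<Rightarrow> real) set" where
  "V_space r = {a \<in> {1..r+1} \<rightarrow>\<^sub>E UNIV. (\<Sum>i=1..r+1. a i) = 0}"

text \<open>\<open>V_vec r a\<close> is \<open>\<Sum>\<^sub>i a\<^sub>i (e\<^sub>i - e\<^bsub>r+1\<^esub>)\<close>, the sum ranging over \<open>1 \<le> i \<le> r\<close>.\<close>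

definition V_vec :: "nat \<Rightarrow> (nat \<Rightarrow> real) \<Rightarrow> nat \<Rightarrow> real" where
  "V_vec r a = (\<lambda>v\<in>{1..r+1}. \<Sum>i=1..r. a i * (basis_vec r i v - basis_vec r (r+1) v))"

definition root_lattice :: "nat \<Rightarrow> (nat \<Rightarrow> real) set" where
  "root_lattice r =
     {(\<lambda>v\<in>{1..r+1}. \<Sum>(i, j)\<in>{(i, j). 1 \<le> i \<and> i < j \<and> j \<le> r + 1}.
          of_int (c i j) * (basis_vec r i v - basis_vec r j v)) |c :: nat \<Rightarrow> nat \<Rightarrow> int. True}"

text \<open>
  The vectors \<open>e\<^sub>i - e\<^bsub>r+1\<^esub>\<close> with \<open>1 \<le> i \<le> r\<close> form a basis of the lattice generated by the
  positive roots, so the Lebesgue measure on \<open>V\<close> giving that lattice covolume \<open>1\<close> is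
  the image of the standard Lebesgue measure under \<open>V_vec r\<close>.
\<close>

lemma root_lattice_eq: "root_lattice r = {V_vec r (\<lambda>i. of_int (z i)) |z :: nat \<Rightarrow> int. True}"
proof -
  let ?R = "{(i, j). 1 \<le> i \<and> i < j \<and> j \<le> r + 1}"
  have R: "?R = (SIGMA i:{1..r+1}. {i<..r+1})" by auto
  have fin: "finite ?R" unfolding R by auto
  let ?b = "basis_vec r"
  have "\<exists>z :: nat \<Rightarrow> int. (\<lambda>v\<in>{1..r+1}. \<Sum>(i, j)\<in>?R. of_int (c i j) * (?b i v - ?b j v))
          = V_vec r (\<lambda>i. of_int (z i))" for c :: "nat \<Rightarrow> nat \<Rightarrow> int"
  proof -
    define z where "z k = (\<Sum>(i, j)\<in>?R. c i j * (of_bool (i = k) - of_bool (j = k)))" for k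
    have s: "(\<Sum>k=1..r. of_int (of_bool (i = k)) * (?b k v - ?b (r+1) v)) = ?b i v - ?b (r+1) v"
      if "i \<in> {1..r+1}" for i v
    proof (cases "i = r + 1")
      case True then show ?thesis by (auto intro!: sum.neutral)
    next
      case False
      with that have "i \<in> {1..r}" by auto
      then show ?thesis by (simp add: of_bool_def if_distrib if_distribR sum.delta cong: if_cong)
    qed
    have "V_vec r (\<lambda>i. of_int (z i)) v
        = (\<Sum>(i, j)\<in>?R. of_int (c i j) * (?b i v - ?b j v))" if v: "v \<in> {1..r+1}" for v
    proof -
      have "V_vec r (\<lambda>i. of_int (z i)) v = (\<Sum>k=1..r. \<Sum>(i, j)\<in>?R.
          of_int (c i j) * (of_int (of_bool (i = k)) - of_int (of_bool (j = k))) * (?b k v - ?b (r+1) v))"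
        using v unfolding V_vec_def z_def
        by (simp add: sum_distrib_right case_prod_unfold)
      also have "\<dots> = (\<Sum>(i, j)\<in>?R. \<Sum>k=1..r.
          of_int (c i j) * (of_int (of_bool (i = k)) - of_int (of_bool (j = k))) * (?b k v - ?b (r+1) v))"
        by (subst sum.swap) (simp add: case_prod_unfold)
      also have "\<dots> = (\<Sum>(i, j)\<in>?R. of_int (c i j) *
           ((\<Sum>k=1..r. of_int (of_bool (i = k)) * (?b k v - ?b (r+1) v))
          - (\<Sum>k=1..r. of_int (of_bool (j = k)) * (?b k v - ?b (r+1) v))))"
        by (intro sum.cong refl) (auto simp: sum_subtractf[symmetric] sum_distrib_left algebra_simps)
      also have "\<dots> = (\<Sum>(i, j)\<in>?R. of_int (c i j) * (?b i v - ?b j v))"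
      proof (intro sum.cong refl, clarify)
        fix i j :: nat assume "1 \<le> i" "i < j" "j \<le> r + 1"
        then show "of_int (c i j) *
           ((\<Sum>k=1..r. of_int (of_bool (i = k)) * (?b k v - ?b (r+1) v))
          - (\<Sum>k=1..r. of_int (of_bool (j = k)) * (?b k v - ?b (r+1) v)))
          = of_int (c i j) * (?b i v - ?b j v)"
          by (subst (1 2) s) auto
      qed
      finally show ?thesis .
    qed
    then have "(\<lambda>v\<in>{1..r+1}. \<Sum>(i, j)\<in>?R. of_int (c i j) * (?b i v - ?b j v))
          = V_vec r (\<lambda>i. of_int (z i))"
      by (intro ext) (auto simp: restrict_def V_vec_def)
    then show ?thesis by blast
  qed
  moreover have "\<exists>c :: nat \<Rightarrow> nat \<Rightarrow> int. V_vec r (\<lambda>i. of_int (z i))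
     = (\<lambda>v\<in>{1..r+1}. \<Sum>(i, j)\<in>?R. of_int (c i j) * (?b i v - ?b j v))" for z :: "nat \<Rightarrow> int"
  proof -
    define c where "c i j = (if j = r + 1 then z i else 0)" for i j :: nat
    have "(\<Sum>(i, j)\<in>?R. of_int (c i j) * (?b i v - ?b j v))
        = (\<Sum>i=1..r. of_int (z i) * (?b i v - ?b (r+1) v))" for v
    proof -
      have "(\<Sum>(i, j)\<in>?R. of_int (c i j) * (?b i v - ?b j v))
         = (\<Sum>(i, j)\<in>(\<lambda>i. (i, r+1)) ` {1..r}. of_int (c i j) * (?b i v - ?b j v))"
        by (rule sum.mono_neutral_right[OF fin]) (auto simp: c_def)
      also have "\<dots> = (\<Sum>i=1..r. of_int (z i) * (?b i v - ?b (r+1) v))"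
        by (subst sum.reindex) (auto simp: inj_on_def c_def)
      finally show ?thesis .
    qed
    then show ?thesis unfolding V_vec_def by (intro exI[of _ c]) simp
  qed
  ultimately show ?thesis unfolding root_lattice_def by blast
qed

definition V_lebesgue :: "nat \<Rightarrow> (nat \<Rightarrow> real) measure" where
  "V_lebesgue r =
     distr (\<Pi>\<^sub>M i\<in>{1..r}. lborel) (\<Pi>\<^sub>M i\<in>{1..r+1}. lborel) (V_vec r)"


section \<open>Flow polytopes and their volumes\<close>

type_synonym coord = "nat \<times> nat \<times> nat"

definition flow_coords :: "nat \<Rightarrow> (nat \<Rightarrow> nat \<Rightarrow> nat) \<Rightarrow> coord set" where
  "flow_coords r m = {(i, j, k). 1 \<le> i \<and> i < j \<and> j \<le> r + 1 \<and> 1 \<le> k \<and> k \<le> m i j}"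

definition U_lebesgue :: "nat \<Rightarrow> (nat \<Rightarrow> nat \<Rightarrow> nat) \<Rightarrow> (coord \<Rightarrow> real) measure" where
  "U_lebesgue r m = (\<Pi>\<^sub>M e\<in>flow_coords r m. lborel)"

definition flow_map :: "nat \<Rightarrow> (nat \<Rightarrow> nat \<Rightarrow> nat) \<Rightarrow> (coord \<Rightarrow> real) \<Rightarrow> nat \<Rightarrow> real" where
  "flow_map r m y =
     (\<lambda>v\<in>{1..r+1}. \<Sum>(i, j, k)\<in>flow_coords r m.
        y (i, j, k) * (basis_vec r i v - basis_vec r j v))"

definition flow_polytope ::
    "nat \<Rightarrow> (nat \<Rightarrow> nat \<Rightarrow> nat) \<Rightarrow> (nat \<Rightarrow> real) \<Rightarrow> (coord \<Rightarrow> real) set" where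
  "flow_polytope r m a =
     {y \<in> flow_coords r m \<rightarrow>\<^sub>E UNIV. (\<forall>e\<in>flow_coords r m. 0 \<le> y e) \<and> flow_map r m y = a}"

text \<open>
  The quotient measure \<open>du/da\<close>: measures \<open>\<nu> a\<close> on the fibres of \<open>flow_map r m\<close> over the
  points \<open>a\<close> of \<open>V\<close>, carried into each other by the translations of the total space
  (so all of them are the same Haar measure on the kernel), which disintegrate \<open>du\<close>
  with respect to \<open>da\<close>. These conditions determine \<open>\<nu> a\<close> for every \<open>a \<in> V_space r\<close>;
  the values of \<open>\<nu>\<close> outside \<open>V_space r\<close> are irrelevant.
\<close>

definition is_quotient_measure ::
    "nat \<Rightarrow> (nat \<Rightarrow> nat \<Rightarrow> nat) \<Rightarrow> ((nat \<Rightarrow> real) \<Rightarrow> (coord \<Rightarrow> real) measure) \<Rightarrow> bool" where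
  "is_quotient_measure r m \<nu> \<longleftrightarrow>
     (\<forall>a\<in>V_space r. sets (\<nu> a) = sets (U_lebesgue r m) \<and> (AE y in \<nu> a. flow_map r m y = a)) \<and>
     (\<forall>a\<in>V_space r. \<forall>u\<in>space (U_lebesgue r m).
        \<nu> (\<lambda>i\<in>{1..r+1}. a i + flow_map r m u i) =
          distr (\<nu> a) (U_lebesgue r m) (\<lambda>y. \<lambda>e\<in>flow_coords r m. y e + u e)) \<and>
     (\<forall>B\<in>sets (U_lebesgue r m).
        emeasure (U_lebesgue r m) B = (\<integral>\<^sup>+ a. emeasure (\<nu> a) B \<partial>V_lebesgue r))"

definition quotient_measure ::
    "nat \<Rightarrow> (nat \<Rightarrow> nat \<Rightarrow> nat) \<Rightarrow> (nat \<Rightarrow> real) \<Rightarrow> (coord \<Rightarrow> real) measure" where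
  "quotient_measure r m = (SOME \<nu>. is_quotient_measure r m \<nu>)"

definition flow_volume :: "nat \<Rightarrow> (nat \<Rightarrow> nat \<Rightarrow> nat) \<Rightarrow> (nat \<Rightarrow> real) \<Rightarrow> real" where
  "flow_volume r m a = measure (quotient_measure r m a) (flow_polytope r m a)"

definition nice_chamber :: "nat \<Rightarrow> (nat \<Rightarrow> real) set" where
  "nice_chamber r = {V_vec r a |a. \<forall>i\<in>{1..r}. 0 < a i}"

text \<open>
  For \<open>x \<in> V_space r\<close> the coefficients of \<open>x\<close> in the basis \<open>e\<^sub>i - e\<^bsub>r+1\<^esub>\<close> are
  \<open>x 1, \<dots>, x r\<close>, and only these are read by a polynomial in the first \<open>r\<close> variables.
  The polynomial is unique because the chamber spans a full-dimensional cone.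
\<close>

definition nice_volume_poly :: "nat \<Rightarrow> (nat \<Rightarrow> nat \<Rightarrow> nat) \<Rightarrow> mpoly" where
  "nice_volume_poly r m =
     (THE p. homogeneous r (num_coords r m - r) p \<and>
        (\<forall>x\<in>closure (nice_chamber r). eval_mpoly x p = flow_volume r m x))"

end

theory Submission
  imports Defs "HOL-Library.Multiset"
begin

text \<open>
  The operators \<open>(\<Prod>\<^sub>j (\<partial>\<^sub>l - \<partial>\<^sub>j)\<^bsup>m l j\<^esup>) \<partial>\<^sub>l\<^bsup>m l (r+1)\<^esup>\<close> are monic in \<open>\<partial>\<^sub>l\<close> and their other terms only trade
  \<open>\<partial>\<^sub>l\<close> for \<open>\<partial>\<^sub>j\<close> with \<open>j > l\<close>. So a homogeneous solution is determined by its derivatives of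
  exponent less than the order of the \<open>l\<close>-th operator in each \<open>\<partial>\<^sub>l\<close>. No such derivative has order
  greater than \<open>M - r\<close>, and exactly one has order \<open>M - r\<close>.

  Solving the flow equations for the coordinates \<open>(l, r + 1, 1)\<close> identifies the fibres
  with slack polytopes in the remaining coordinates, and integrating over these one at a time,
  edges with larger source first, expresses the volume by iterated line integrals
  \<open>\<integral>\<^sub>0\<^bsup>a l\<^esup> f (a - t (e\<^sub>l - e\<^sub>j)) dt\<close>. Each of these is a right inverse of \<open>\<partial>\<^sub>l - \<partial>\<^sub>j\<close> and commutes with the
  partial derivatives in all variables but \<open>a\<^sub>l\<close>, hence the volume is a nonzero solution of degree
  \<open>M - r\<close>; its derivatives are solutions of all smaller degrees.
\<close>

section \<open>Differentiation and integration of polynomials\<close>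

lemma partial_0 [simp]: "partial i 0 = 0"
  by (rule poly_mapping_eqI) (simp add: lookup_partial)

lemma partial_add: "partial i (p + q) = partial i p + partial i q"
  by (rule poly_mapping_eqI) (simp add: lookup_partial lookup_add algebra_simps)

lemma partial_diff: "partial i (p - q) = partial i p - partial i q"
  by (rule poly_mapping_eqI) (simp add: lookup_partial lookup_minus algebra_simps)

lemma partial_sum: "partial i (sum f K) = (\<Sum>k\<in>K. partial i (f k))"
  by (induction K rule: infinite_finite_induct) (auto simp: partial_add)

lemma partial_one [simp]: "partial i 1 = 0"
proof (rule poly_mapping_eqI)
  fix \<beta> :: "nat \<Rightarrow>\<^sub>0 nat"
  have "\<beta> + Poly_Mapping.single i 1 \<noteq> 0"
  proof
    assume "\<beta> + Poly_Mapping.single i 1 = 0"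
    then have "Poly_Mapping.lookup (\<beta> + Poly_Mapping.single i 1) i = 0" by simp
    then show False by (simp add: lookup_add)
  qed
  then show "Poly_Mapping.lookup (partial i 1) \<beta> = Poly_Mapping.lookup 0 \<beta>"
    by (simp add: lookup_partial lookup_one)
qed

lemma partial_commute: "partial i (partial j p) = partial j (partial i p)"
  by (rule poly_mapping_eqI)
     (cases "i = j", auto simp: lookup_partial lookup_add lookup_single algebra_simps)

lemma lookup_const_mult: "Poly_Mapping.lookup (const_mpoly c * p) \<alpha> = c * Poly_Mapping.lookup p \<alpha>"
  unfolding const_mpoly_def mult_map_scale_conv_mult[symmetric]
  by (simp add: map.rep_eq when_def)

lemma partial_const_mult: "partial i (const_mpoly c * p) = const_mpoly c * partial i p"
  by (rule poly_mapping_eqI) (simp add: lookup_partial lookup_const_mult)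

text \<open>Every monomial gains a factor of the variable \<open>i\<close>, so this is the
  antiderivative that vanishes where that variable is 0. The normalisation later gives the line
  integrals their boundary value.\<close>

definition antideriv :: "nat \<Rightarrow> mpoly \<Rightarrow> mpoly" where
  "antideriv i p =
     (\<Sum>\<alpha>\<in>Poly_Mapping.keys p. Poly_Mapping.single (\<alpha> + Poly_Mapping.single i 1)
        (Poly_Mapping.lookup p \<alpha> / of_nat (Poly_Mapping.lookup \<alpha> i + 1)))"

lemma lookup_antideriv:
  "Poly_Mapping.lookup (antideriv i p) \<beta> =
     (if Poly_Mapping.lookup \<beta> i = 0 then 0
      else Poly_Mapping.lookup p (\<beta> - Poly_Mapping.single i 1) / of_nat (Poly_Mapping.lookup \<beta> i))"
proof -
  let ?e = "Poly_Mapping.single i (1::nat)"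
  have eq: "Poly_Mapping.lookup
          (Poly_Mapping.single (\<alpha> + ?e) (Poly_Mapping.lookup p \<alpha> / of_nat (Poly_Mapping.lookup \<alpha> i + 1))) \<beta>
        = (if \<alpha> = \<beta> - ?e then (if Poly_Mapping.lookup \<beta> i = 0 then 0 else
             Poly_Mapping.lookup p (\<beta> - ?e) / of_nat (Poly_Mapping.lookup \<beta> i)) else 0)"
    for \<alpha>
  proof (cases "Poly_Mapping.lookup \<beta> i = 0")
    case True
    then have "\<alpha> + ?e \<noteq> \<beta>" by (auto simp: lookup_add)
    with True show ?thesis by (simp add: lookup_single when_def)
  next
    case False
    then have "\<beta> - ?e + ?e = \<beta>"
      by (intro poly_mapping_eqI) (auto simp: lookup_add lookup_minus lookup_single when_def)
    then have "\<alpha> + ?e = \<beta> \<longleftrightarrow> \<alpha> = \<beta> - ?e" by auto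
    with False show ?thesis by (auto simp: lookup_single when_def lookup_minus)
  qed
  show ?thesis
    unfolding antideriv_def lookup_sum eq
    by (auto simp: sum.delta in_keys_iff)
qed

lemma antideriv_0 [simp]: "antideriv i 0 = 0"
  by (rule poly_mapping_eqI) (simp add: lookup_antideriv)

lemma antideriv_diff: "antideriv i (p - q) = antideriv i p - antideriv i q"
  by (rule poly_mapping_eqI) (simp add: lookup_antideriv lookup_minus diff_divide_distrib)

lemma partial_antideriv [simp]: "partial i (antideriv i p) = p"
  by (rule poly_mapping_eqI) (simp add: lookup_partial lookup_antideriv lookup_add)

lemma partial_antideriv_commute:
  assumes "i \<noteq> j"
  shows "partial i (antideriv j p) = antideriv j (partial i p)"
proof (rule poly_mapping_eqI)
  fix \<beta> :: "nat \<Rightarrow>\<^sub>0 nat"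
  \<comment> \<open>Subtraction of exponents truncates, hence the restriction to exponents
    containing \<open>j\<close>; at all others both sides of the goal are 0.\<close>
  have "\<beta> + Poly_Mapping.single i 1 - Poly_Mapping.single j 1
      = \<beta> - Poly_Mapping.single j 1 + Poly_Mapping.single i 1"
    if "Poly_Mapping.lookup \<beta> j \<noteq> 0"
    using assms that
    by (intro poly_mapping_eqI) (auto simp: lookup_add lookup_minus lookup_single when_def)
  then show "Poly_Mapping.lookup (partial i (antideriv j p)) \<beta>
      = Poly_Mapping.lookup (antideriv j (partial i p)) \<beta>"
    using assms
    by (auto simp: lookup_partial lookup_antideriv lookup_add lookup_single lookup_minus when_def)
qed

section \<open>Degrees and homogeneity\<close>

lemma exp_degree_superset:
  assumes "finite K" "Poly_Mapping.keys \<alpha> \<subseteq> K"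
  shows "exp_degree \<alpha> = (\<Sum>i\<in>K. Poly_Mapping.lookup \<alpha> i)"
  unfolding exp_degree_def using assms
  by (intro sum.mono_neutral_left) (auto simp: in_keys_iff)

lemma keys_add_nat:
  "Poly_Mapping.keys (\<alpha> + \<beta> :: nat \<Rightarrow>\<^sub>0 nat) = Poly_Mapping.keys \<alpha> \<union> Poly_Mapping.keys \<beta>"
  by (auto simp: in_keys_iff lookup_add)

lemma exp_degree_add: "exp_degree (\<alpha> + \<beta>) = exp_degree \<alpha> + exp_degree \<beta>"
proof -
  let ?K = "Poly_Mapping.keys \<alpha> \<union> Poly_Mapping.keys \<beta>"
  have "exp_degree (\<alpha> + \<beta>) = (\<Sum>i\<in>?K. Poly_Mapping.lookup (\<alpha> + \<beta>) i)"
    by (rule exp_degree_superset) (auto simp: keys_add_nat)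
  also have "\<dots> = exp_degree \<alpha> + exp_degree \<beta>"
    by (simp add: exp_degree_superset[of ?K] lookup_add sum.distrib)
  finally show ?thesis .
qed

lemma exp_degree_single [simp]: "exp_degree (Poly_Mapping.single i n) = n"
  by (simp add: exp_degree_def)

lemma exp_degree_eq_0_iff: "exp_degree \<alpha> = 0 \<longleftrightarrow> \<alpha> = 0"
proof
  assume "exp_degree \<alpha> = 0"
  then have "Poly_Mapping.lookup \<alpha> i = 0" for i
    by (cases "i \<in> Poly_Mapping.keys \<alpha>") (auto simp: exp_degree_def in_keys_iff)
  then show "\<alpha> = 0" by (intro poly_mapping_eqI) simp
qed (simp add: exp_degree_def)

lemma homogeneousD:
  assumes "homogeneous r d p" "Poly_Mapping.lookup p \<alpha> \<noteq> 0"
  shows "Poly_Mapping.keys \<alpha> \<subseteq> {1..r}" "exp_degree \<alpha> = d"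
  using assms by (auto simp: homogeneous_def in_keys_iff)

lemma homogeneousI:
  assumes "\<And>\<alpha>. Poly_Mapping.lookup p \<alpha> \<noteq> 0 \<Longrightarrow> Poly_Mapping.keys \<alpha> \<subseteq> {1..r} \<and> exp_degree \<alpha> = d"
  shows "homogeneous r d p"
  using assms by (auto simp: homogeneous_def in_keys_iff)

lemma homogeneous_0 [simp]: "homogeneous r d 0"
  by (simp add: homogeneous_def)

lemma homogeneous_one [simp]: "homogeneous r 0 1"
  by (simp add: homogeneous_def exp_degree_def)

lemma homogeneous_add: "homogeneous r d p \<Longrightarrow> homogeneous r d q \<Longrightarrow> homogeneous r d (p + q)"
  by (rule homogeneousI) (metis homogeneousD lookup_add add.right_neutral)

lemma homogeneous_diff: "homogeneous r d p \<Longrightarrow> homogeneous r d q \<Longrightarrow> homogeneous r d (p - q)"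
  by (rule homogeneousI) (metis homogeneousD lookup_minus diff_zero)

lemma homogeneous_sum: "(\<And>k. k \<in> K \<Longrightarrow> homogeneous r d (f k)) \<Longrightarrow> homogeneous r d (sum f K)"
  by (induction K rule: infinite_finite_induct) (auto intro: homogeneous_add)

lemma homogeneous_const_mult: "homogeneous r d p \<Longrightarrow> homogeneous r d (const_mpoly c * p)"
  by (rule homogeneousI) (use homogeneousD[of r d p] in \<open>force simp: lookup_const_mult\<close>)

lemma homogeneous_partial:
  assumes "homogeneous r (Suc d) p"
  shows "homogeneous r d (partial i p)"
proof (rule homogeneousI)
  fix \<alpha> assume "Poly_Mapping.lookup (partial i p) \<alpha> \<noteq> 0"
  then have "Poly_Mapping.lookup p (\<alpha> + Poly_Mapping.single i 1) \<noteq> 0"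
    by (auto simp: lookup_partial)
  from homogeneousD[OF assms this] show "Poly_Mapping.keys \<alpha> \<subseteq> {1..r} \<and> exp_degree \<alpha> = d"
    by (auto simp: exp_degree_add keys_add_nat)
qed

lemma partial_homogeneous_0:
  assumes "homogeneous r 0 p"
  shows "partial i p = 0"
proof (rule poly_mapping_eqI)
  fix \<alpha> :: "nat \<Rightarrow>\<^sub>0 nat"
  have "Poly_Mapping.lookup p (\<alpha> + Poly_Mapping.single i 1) = 0"
    using homogeneousD(2)[OF assms, of "\<alpha> + Poly_Mapping.single i 1"]
    by (auto simp: exp_degree_add)
  then show "Poly_Mapping.lookup (partial i p) \<alpha> = Poly_Mapping.lookup 0 \<alpha>"
    by (simp add: lookup_partial)
qed

lemma partial_outside:
  assumes "homogeneous r d p" "i \<notin> {1..r}"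
  shows "partial i p = 0"
proof (rule poly_mapping_eqI)
  fix \<alpha> :: "nat \<Rightarrow>\<^sub>0 nat"
  have "Poly_Mapping.lookup p (\<alpha> + Poly_Mapping.single i 1) = 0"
    using homogeneousD(1)[OF assms(1), of "\<alpha> + Poly_Mapping.single i 1"] assms(2)
    by (auto simp: keys_add_nat)
  then show "Poly_Mapping.lookup (partial i p) \<alpha> = Poly_Mapping.lookup 0 \<alpha>"
    by (simp add: lookup_partial)
qed

lemma homogeneous_antideriv:
  assumes "homogeneous r d p" "i \<in> {1..r}"
  shows "homogeneous r (Suc d) (antideriv i p)"
proof (rule homogeneousI)
  fix \<alpha> assume *: "Poly_Mapping.lookup (antideriv i p) \<alpha> \<noteq> 0"
  then have i: "Poly_Mapping.lookup \<alpha> i \<noteq> 0"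
    and n: "Poly_Mapping.lookup p (\<alpha> - Poly_Mapping.single i 1) \<noteq> 0"
    by (auto simp: lookup_antideriv split: if_splits)
  have eq: "\<alpha> = \<alpha> - Poly_Mapping.single i 1 + Poly_Mapping.single i 1"
    using i by (intro poly_mapping_eqI) (auto simp: lookup_add lookup_minus lookup_single when_def)
  show "Poly_Mapping.keys \<alpha> \<subseteq> {1..r} \<and> exp_degree \<alpha> = Suc d"
    using homogeneousD[OF assms(1) n] assms(2)
    by (subst (1 2) eq) (auto simp: exp_degree_add keys_add_nat)
qed

text \<open>An antiderivative \<open>g\<close> along \<open>\<partial>\<^sub>l - \<partial>\<^sub>j\<close> solves \<open>g = A\<^sub>l f + A\<^sub>l \<partial>\<^sub>j g\<close>, where \<open>A\<^sub>l\<close> is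
  \<^const>\<open>antideriv\<close>; this is the resulting Neumann series, which is finite since \<open>\<partial>\<^sub>j\<close> is nilpotent.\<close>

definition edge_int :: "nat \<Rightarrow> nat \<Rightarrow> nat \<Rightarrow> mpoly \<Rightarrow> mpoly" where
  "edge_int l j n f = (\<Sum>k\<le>n. (antideriv l ^^ Suc k) ((partial j ^^ k) f))"

lemma homogeneous_partial_funpow:
  "homogeneous r (n + k) f \<Longrightarrow> homogeneous r n ((partial j ^^ k) f)"
  by (induction k arbitrary: f) (auto simp: funpow_swap1 intro!: homogeneous_partial)

lemma partial_funpow_eq_0:
  assumes "homogeneous r n f"
  shows "(partial j ^^ Suc n) f = 0"
  using partial_homogeneous_0[OF homogeneous_partial_funpow[of r 0 n f j]] assms by simp

lemma homogeneous_antideriv_funpow: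
  "homogeneous r n f \<Longrightarrow> l \<in> {1..r} \<Longrightarrow> homogeneous r (n + k) ((antideriv l ^^ k) f)"
  by (induction k) (auto intro: homogeneous_antideriv)

lemma homogeneous_edge_int:
  assumes "homogeneous r n f" "l \<in> {1..r}"
  shows "homogeneous r (Suc n) (edge_int l j n f)"
  unfolding edge_int_def
proof (rule homogeneous_sum)
  fix k assume "k \<in> {..n}"
  then have "homogeneous r (n - k) ((partial j ^^ k) f)"
    using homogeneous_partial_funpow[of r "n - k" k f j] assms(1) by simp
  from homogeneous_antideriv_funpow[OF this assms(2), of "Suc k"]
  show "homogeneous r (Suc n) ((antideriv l ^^ Suc k) ((partial j ^^ k) f))"
    using \<open>k \<in> {..n}\<close> by (simp del: funpow.simps)
qed

text \<open>Every factor of the series commutes with \<open>partial i\<close> except possibly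
  \<open>antideriv l\<close>, and that one does as soon as \<open>i\<close> differs from
  \<open>l\<close>. So derivatives in the other variables pass through an integration with source
  \<open>l\<close>.\<close>

lemma partial_edge_int_commute:
  assumes "i \<noteq> l"
  shows "partial i (edge_int l j n f) = edge_int l j n (partial i f)"
proof -
  have a: "partial i ((antideriv l ^^ k) f) = (antideriv l ^^ k) (partial i f)" for k f
    by (induction k) (auto simp: partial_antideriv_commute[OF assms])
  have p: "partial i ((partial j ^^ k) f) = (partial j ^^ k) (partial i f)" for k f
    by (induction k) (simp_all add: partial_commute[of i j])
  show ?thesis unfolding edge_int_def partial_sum a p ..
qed

lemma edge_int_diff: "edge_int l j n (f - g) = edge_int l j n f - edge_int l j n g"
proof -
  have a: "(antideriv l ^^ k) (f - g) = (antideriv l ^^ k) f - (antideriv l ^^ k) g" for k f g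
    by (induction k) (auto simp: antideriv_diff)
  have p: "(partial j ^^ k) (f - g) = (partial j ^^ k) f - (partial j ^^ k) g" for k f g
    by (induction k) (auto simp: partial_diff)
  show ?thesis unfolding edge_int_def a p sum_subtractf ..
qed

lemma edge_int_0 [simp]: "edge_int l j n 0 = 0"
  using edge_int_diff[of l j n 0 0] by simp

text \<open>Put \<open>g k\<close> for \<open>k\<close> applications of \<open>partial j\<close>
  followed by \<open>k\<close> of \<open>antideriv l\<close>. The two derivatives are sums of
  \<open>g\<close> shifted by one place, so their difference telescopes to
  \<open>g 0 - g (Suc n)\<close>, and the last term vanishes because \<open>f\<close> has degree
  \<open>n\<close>.\<close>

lemma diff_edge_int:
  assumes "homogeneous r n f" "j \<noteq> l"
  shows "partial l (edge_int l j n f) - partial j (edge_int l j n f) = f"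
proof -
  define g where "g k = (antideriv l ^^ k) ((partial j ^^ k) f)" for k
  have "partial l (edge_int l j n f) = (\<Sum>k\<le>n. g k)"
    by (simp add: edge_int_def partial_sum g_def)
  moreover have "partial j (edge_int l j n f) = (\<Sum>k\<le>n. g (Suc k))"
  proof -
    have a: "partial j ((antideriv l ^^ k) f) = (antideriv l ^^ k) (partial j f)" for k f
      by (induction k) (auto simp: partial_antideriv_commute[OF assms(2)])
    show ?thesis unfolding edge_int_def partial_sum a g_def by simp
  qed
  moreover have "(\<Sum>k\<le>n. g k) - (\<Sum>k\<le>n. g (Suc k)) = g 0 - g (Suc n)"
    by (simp add: sum_subtractf[symmetric] sum_telescope)
  moreover have "g (Suc n) = 0"
  proof -
    have "(antideriv l ^^ k) 0 = 0" for k by (induction k) auto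
    then show ?thesis unfolding g_def using partial_funpow_eq_0[OF assms(1)] by simp
  qed
  ultimately show ?thesis by (simp add: g_def)
qed

text \<open>A monomial of positive degree contains some variable, and differentiating in it
  multiplies the coefficient by a nonzero integer.\<close>

lemma homogeneous_eq_0_if_partials_0:
  assumes "homogeneous r (Suc d) p" "\<And>i. i \<in> {1..r} \<Longrightarrow> partial i p = 0"
  shows "p = 0"
proof (rule ccontr)
  assume "p \<noteq> 0"
  then obtain \<alpha> where \<alpha>: "Poly_Mapping.lookup p \<alpha> \<noteq> 0"
    by (metis poly_mapping_eqI lookup_zero)
  from homogeneousD[OF assms(1) this] have *: "Poly_Mapping.keys \<alpha> \<subseteq> {1..r}" "exp_degree \<alpha> = Suc d" .
  then have "\<alpha> \<noteq> 0" using exp_degree_eq_0_iff[of \<alpha>] by auto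
  then obtain i where i: "i \<in> Poly_Mapping.keys \<alpha>"
    by (metis all_not_in_conv keys_eq_empty)
  have "\<alpha> = \<alpha> - Poly_Mapping.single i 1 + Poly_Mapping.single i 1"
    using i by (intro poly_mapping_eqI) (auto simp: lookup_add lookup_minus lookup_single when_def in_keys_iff)
  then have "Poly_Mapping.lookup (partial i p) (\<alpha> - Poly_Mapping.single i 1) \<noteq> 0"
    using \<alpha> by (simp add: lookup_partial del: add_diff_cancel_right')
  with assms(2)[of i] i * show False by auto
qed

section \<open>Values of polynomials\<close>

lemma eval_mpoly_superset:
  assumes "finite S" "Poly_Mapping.keys p \<subseteq> S"
  shows "eval_mpoly x p = (\<Sum>\<alpha>\<in>S. Poly_Mapping.lookup p \<alpha> *
        (\<Prod>i\<in>Poly_Mapping.keys \<alpha>. x i ^ Poly_Mapping.lookup \<alpha> i))"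
  unfolding eval_mpoly_def using assms
  by (intro sum.mono_neutral_left) (auto simp: in_keys_iff)

lemma eval_mpoly_0 [simp]: "eval_mpoly x 0 = 0"
  by (simp add: eval_mpoly_def)

lemma eval_mpoly_add: "eval_mpoly x (p + q) = eval_mpoly x p + eval_mpoly x q"
proof -
  let ?S = "Poly_Mapping.keys p \<union> Poly_Mapping.keys q"
  have "Poly_Mapping.keys (p + q) \<subseteq> ?S" by (rule keys_add)
  then show ?thesis
    by (simp add: eval_mpoly_superset[of ?S] lookup_add distrib_right sum.distrib)
qed

lemma eval_mpoly_diff: "eval_mpoly x (p - q) = eval_mpoly x p - eval_mpoly x q"
  using eval_mpoly_add[of x "p - q" q] by simp

lemma eval_mpoly_sum: "eval_mpoly x (sum f K) = (\<Sum>k\<in>K. eval_mpoly x (f k))"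
  by (induction K rule: infinite_finite_induct) (auto simp: eval_mpoly_add)

lemma eval_mpoly_single:
  "eval_mpoly x (Poly_Mapping.single \<alpha> c) =
     c * (\<Prod>i\<in>Poly_Mapping.keys \<alpha>. x i ^ Poly_Mapping.lookup \<alpha> i)"
  by (auto simp: eval_mpoly_def)

lemma eval_mpoly_antideriv:
  assumes "x l = 0"
  shows "eval_mpoly x (antideriv l p) = 0"
  unfolding eval_mpoly_def
proof (rule sum.neutral, intro ballI)
  fix \<alpha> assume "\<alpha> \<in> Poly_Mapping.keys (antideriv l p)"
  then have "l \<in> Poly_Mapping.keys \<alpha>"
    by (auto simp: in_keys_iff lookup_antideriv split: if_splits)
  then have "(\<Prod>i\<in>Poly_Mapping.keys \<alpha>. x i ^ Poly_Mapping.lookup \<alpha> i) = 0"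
    using assms by (intro prod_zero) (auto simp: in_keys_iff intro!: bexI[of _ l])
  then show "Poly_Mapping.lookup (antideriv l p) \<alpha> *
      (\<Prod>i\<in>Poly_Mapping.keys \<alpha>. x i ^ Poly_Mapping.lookup \<alpha> i) = 0" by simp
qed

text \<open>The boundary value that complements \<open>diff_edge_int\<close>: together they identify
  \<open>edge_int\<close> with the line integral ending on the hyperplane where coordinate
  \<open>l\<close> is 0.\<close>

lemma eval_mpoly_edge_int:
  "x l = 0 \<Longrightarrow> eval_mpoly x (edge_int l j n f) = 0"
  by (simp add: edge_int_def eval_mpoly_sum eval_mpoly_antideriv)

text \<open>The chain rule along a line, proved monomial by monomial. \<open>K\<close> may exceed
  the variables of \<open>p\<close>, so that the direction \<open>u\<close> can later involve the
  vertex \<open>r + 1\<close>.\<close>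

lemma DERIV_eval_mpoly:
  assumes K: "finite K" and p: "\<And>\<alpha>. \<alpha> \<in> Poly_Mapping.keys p \<Longrightarrow> Poly_Mapping.keys \<alpha> \<subseteq> K"
  shows "((\<lambda>t. eval_mpoly (\<lambda>i. x i + t * u i) p) has_real_derivative
            (\<Sum>i\<in>K. u i * eval_mpoly (\<lambda>i. x i + t * u i) (partial i p))) (at t)"
proof -
  define z where "z t i = x i + t * u i" for t i
  have m: "((\<lambda>t. \<Prod>i\<in>Poly_Mapping.keys \<alpha>. z t i ^ Poly_Mapping.lookup \<alpha> i) has_real_derivative
      (\<Sum>i\<in>K. u i * (of_nat (Poly_Mapping.lookup \<alpha> i) *
         (\<Prod>k\<in>Poly_Mapping.keys (\<alpha> - Poly_Mapping.single i 1).
             z t k ^ Poly_Mapping.lookup (\<alpha> - Poly_Mapping.single i 1) k)))) (at t)"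
    (is "(_ has_real_derivative ?D) _") if "Poly_Mapping.keys \<alpha> \<subseteq> K" for \<alpha>
  proof -
    have d: "((\<lambda>t. z t i ^ n) has_real_derivative (of_nat n * u i * z t i ^ (n - 1))) (at t)" for i n
      unfolding z_def by (auto intro!: derivative_eq_intros)
    have "((\<lambda>t. \<Prod>i\<in>Poly_Mapping.keys \<alpha>. z t i ^ Poly_Mapping.lookup \<alpha> i) has_real_derivative
      (\<Sum>i\<in>Poly_Mapping.keys \<alpha>. (of_nat (Poly_Mapping.lookup \<alpha> i) * u i * z t i ^ (Poly_Mapping.lookup \<alpha> i - 1)) *
         (\<Prod>k\<in>Poly_Mapping.keys \<alpha> - {i}. z t k ^ Poly_Mapping.lookup \<alpha> k))) (at t)"
      (is "(_ has_real_derivative ?D') _")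
      by (rule has_field_derivative_prod) (rule d)
    moreover have "?D = ?D'"
    proof -
      have "?D = (\<Sum>i\<in>Poly_Mapping.keys \<alpha>. u i * (of_nat (Poly_Mapping.lookup \<alpha> i) *
         (\<Prod>k\<in>Poly_Mapping.keys (\<alpha> - Poly_Mapping.single i 1).
             z t k ^ Poly_Mapping.lookup (\<alpha> - Poly_Mapping.single i 1) k)))"
        using that K by (intro sum.mono_neutral_right) (auto simp: in_keys_iff)
      also have "\<dots> = ?D'"
      proof (rule sum.cong)
        fix i assume i: "i \<in> Poly_Mapping.keys \<alpha>"
        let ?\<beta> = "\<alpha> - Poly_Mapping.single i 1"
        have "(\<Prod>k\<in>Poly_Mapping.keys ?\<beta>. z t k ^ Poly_Mapping.lookup ?\<beta> k)
            = (\<Prod>k\<in>Poly_Mapping.keys \<alpha>. z t k ^ Poly_Mapping.lookup ?\<beta> k)"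
          by (rule prod.mono_neutral_left)
             (auto simp: in_keys_iff lookup_minus lookup_single when_def split: if_splits)
        also have "\<dots> = z t i ^ (Poly_Mapping.lookup \<alpha> i - 1) *
             (\<Prod>k\<in>Poly_Mapping.keys \<alpha> - {i}. z t k ^ Poly_Mapping.lookup ?\<beta> k)"
          using i by (subst prod.remove[of _ i]) (auto simp: lookup_minus)
        also have "(\<Prod>k\<in>Poly_Mapping.keys \<alpha> - {i}. z t k ^ Poly_Mapping.lookup ?\<beta> k)
           = (\<Prod>k\<in>Poly_Mapping.keys \<alpha> - {i}. z t k ^ Poly_Mapping.lookup \<alpha> k)"
          by (rule prod.cong) (auto simp: lookup_minus lookup_single)
        finally show "u i * (of_nat (Poly_Mapping.lookup \<alpha> i) *
             (\<Prod>k\<in>Poly_Mapping.keys ?\<beta>. z t k ^ Poly_Mapping.lookup ?\<beta> k))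
           = (of_nat (Poly_Mapping.lookup \<alpha> i) * u i * z t i ^ (Poly_Mapping.lookup \<alpha> i - 1)) *
         (\<Prod>k\<in>Poly_Mapping.keys \<alpha> - {i}. z t k ^ Poly_Mapping.lookup \<alpha> k)"
          by simp
      qed simp
      finally show ?thesis .
    qed
    ultimately show ?thesis by simp
  qed
  have "((\<lambda>t. eval_mpoly (z t) p) has_real_derivative
     (\<Sum>\<alpha>\<in>Poly_Mapping.keys p. Poly_Mapping.lookup p \<alpha> *
        (\<Sum>i\<in>K. u i * (of_nat (Poly_Mapping.lookup \<alpha> i) *
         (\<Prod>k\<in>Poly_Mapping.keys (\<alpha> - Poly_Mapping.single i 1).
             z t k ^ Poly_Mapping.lookup (\<alpha> - Poly_Mapping.single i 1) k))))) (at t)"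
    unfolding eval_mpoly_def by (intro DERIV_sum DERIV_cmult m p)
  also have "(\<Sum>\<alpha>\<in>Poly_Mapping.keys p. Poly_Mapping.lookup p \<alpha> *
        (\<Sum>i\<in>K. u i * (of_nat (Poly_Mapping.lookup \<alpha> i) *
         (\<Prod>k\<in>Poly_Mapping.keys (\<alpha> - Poly_Mapping.single i 1).
             z t k ^ Poly_Mapping.lookup (\<alpha> - Poly_Mapping.single i 1) k))))
     = (\<Sum>i\<in>K. u i * eval_mpoly (z t) (partial i p))"
    unfolding partial_def eval_mpoly_sum eval_mpoly_single sum_distrib_left
    by (subst sum.swap) (simp add: mult_ac)
  finally show ?thesis unfolding z_def .
qed

text \<open>Induction on the degree: the positive orthant is open in each coordinate direction, so
  the partial derivatives vanish on it as well.\<close>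

lemma homogeneous_eq_0_if_eval_0:
  assumes "homogeneous r d p" "\<And>x. (\<And>i. i \<in> {1..r} \<Longrightarrow> 0 < x i) \<Longrightarrow> eval_mpoly x p = 0"
  shows "p = 0"
  using assms
proof (induction d arbitrary: p)
  case 0
  have "Poly_Mapping.lookup p \<alpha> = 0" if "\<alpha> \<noteq> 0" for \<alpha>
    using homogeneousD(2)[OF 0(1), of \<alpha>] that exp_degree_eq_0_iff by auto
  then have p: "p = Poly_Mapping.single 0 (Poly_Mapping.lookup p 0)"
    by (intro poly_mapping_eqI) (auto simp: lookup_single when_def)
  have "eval_mpoly (\<lambda>i. 1) (Poly_Mapping.single 0 (Poly_Mapping.lookup p 0)) = 0"
    using 0(2)[of "\<lambda>i. 1"] p by simp
  then have "Poly_Mapping.lookup p 0 = 0" by (simp add: eval_mpoly_single)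
  with p show ?case by simp
next
  case (Suc d)
  show ?case
  proof (rule homogeneous_eq_0_if_partials_0[OF Suc.prems(1)])
    fix l assume l: "l \<in> {1..r}"
    show "partial l p = 0"
    proof (rule Suc.IH[OF homogeneous_partial[OF Suc.prems(1)]])
      fix x :: "nat \<Rightarrow> real" assume x: "\<And>i. i \<in> {1..r} \<Longrightarrow> 0 < x i"
      define u where "u i = (if i = l then 1 else 0 :: real)" for i
      have "((\<lambda>t. eval_mpoly (\<lambda>i. x i + t * u i) p) has_real_derivative
            (\<Sum>i\<in>{1..r}. u i * eval_mpoly (\<lambda>i. x i + 0 * u i) (partial i p))) (at 0)"
        using Suc.prems(1) by (intro DERIV_eval_mpoly) (auto simp: homogeneous_def)
      also have "(\<Sum>i\<in>{1..r}. u i * eval_mpoly (\<lambda>i. x i + 0 * u i) (partial i p))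
          = (\<Sum>i\<in>{1..r}. if i = l then eval_mpoly x (partial i p) else 0)"
        by (rule sum.cong) (auto simp: u_def)
      also have "\<dots> = eval_mpoly x (partial l p)"
        using l by (simp add: sum.delta)
      finally have d: "((\<lambda>t. eval_mpoly (\<lambda>i. x i + t * u i) p) has_real_derivative
         eval_mpoly x (partial l p)) (at 0)" .
      \<comment> \<open>Moving coordinate \<open>l\<close> by less than \<open>x l\<close> keeps it
        positive.\<close>
      have "\<exists>e>0. \<forall>t. \<bar>t\<bar> < e \<longrightarrow> eval_mpoly (\<lambda>i. x i + t * u i) p = 0"
      proof (intro exI[of _ "x l"] conjI allI impI)
        show "0 < x l" using x l by auto
        fix t assume "\<bar>t\<bar> < x l"
        then show "eval_mpoly (\<lambda>i. x i + t * u i) p = 0"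
          using x by (intro Suc.prems(2)) (auto simp: u_def)
      qed
      then obtain e where e: "e > 0" "\<And>t. \<bar>t\<bar> < e \<Longrightarrow> eval_mpoly (\<lambda>i. x i + t * u i) p = 0" by blast
      have "((\<lambda>t. 0) has_real_derivative eval_mpoly x (partial l p)) (at 0)"
      proof (rule has_field_derivative_transform_within[OF d e(1)])
        fix t :: real assume "dist t 0 < e"
        then show "eval_mpoly (\<lambda>i. x i + t * u i) p = 0" using e(2) by simp
      qed simp
      then show "eval_mpoly x (partial l p) = 0"
        using DERIV_const DERIV_unique by blast
    qed
  qed
qed

section \<open>The solution space\<close>

declare upt_Suc [simp del]

lemma foldr_replicate_funpow: "foldr f (replicate n x) = f x ^^ n"
  by (induction n) auto

text \<open>A power becomes a repeated list entry, so that inductions treat one linear factor at a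
  time.\<close>

abbreviation diff_ops :: "nat \<Rightarrow> nat list \<Rightarrow> mpoly \<Rightarrow> mpoly" where
  "diff_ops l js \<equiv> foldr (\<lambda>j p. partial l p - partial j p) js"

lemma diff_ops_diff: "diff_ops l js (p - q) = diff_ops l js p - diff_ops l js q"
  by (induction js) (auto simp: partial_diff)

lemma flow_operator_eq_diff_ops:
  "flow_operator r m l \<phi> =
     diff_ops l (concat (map (\<lambda>j. replicate (m l j) j) [l + 1..<r + 1]))
       ((partial l ^^ m l (r + 1)) \<phi>)"
proof -
  have "foldr (\<lambda>j. (\<lambda>p. partial l p - partial j p) ^^ m l j) js =
        diff_ops l (concat (map (\<lambda>j. replicate (m l j) j) js))" for js
    by (induction js) (simp_all add: foldr_replicate_funpow)
  then show ?thesis by (simp add: flow_operator_def)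
qed

lemma partial_funpow_diff: "(partial i ^^ n) (p - q) = (partial i ^^ n) p - (partial i ^^ n) q"
  by (induction n) (auto simp: partial_diff)

lemma flow_operator_diff:
  "flow_operator r m l (p - q) = flow_operator r m l p - flow_operator r m l q"
  by (simp add: flow_operator_eq_diff_ops diff_ops_diff partial_funpow_diff)

text \<open>The operator is built from derivatives of index at least \<open>l\<close> and
  differences only. It is applied with \<open>T\<close> a partial derivative, multiplication by a
  constant, or an \<open>edge_int\<close> whose source is smaller than \<open>l\<close>.\<close>

lemma flow_operator_commute:
  assumes "\<And>p q. T (p - q) = T p - T q" "\<And>i p. l \<le> i \<Longrightarrow> T (partial i p) = partial i (T p)"
  shows "T (flow_operator r m l \<phi>) = flow_operator r m l (T \<phi>)"
proof -
  have f: "T ((partial l ^^ n) \<phi>) = (partial l ^^ n) (T \<phi>)" for n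
    by (induction n) (auto simp: assms)
  have "T (diff_ops l js \<psi>) = diff_ops l js (T \<psi>)" if "set js \<subseteq> {l..}" for js \<psi>
    using that by (induction js) (auto simp: assms)
  then show ?thesis
    unfolding flow_operator_eq_diff_ops f[symmetric] by this auto
qed

lemma solves_flow_system_partial:
  assumes "solves_flow_system r m \<phi>"
  shows "solves_flow_system r m (partial i \<phi>)"
  unfolding solves_flow_system_def
proof
  fix l assume "l \<in> {1..r}"
  have "flow_operator r m l (partial i \<phi>) = partial i (flow_operator r m l \<phi>)"
    by (rule flow_operator_commute[symmetric]) (auto simp: partial_diff intro: partial_commute)
  with \<open>l \<in> {1..r}\<close> assms show "flow_operator r m l (partial i \<phi>) = 0"
    by (simp add: solves_flow_system_def)
qed

section \<open>Mixed derivatives and reduction by leading terms\<close>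

interpretation partial: comp_fun_commute partial
  by standard (simp add: fun_eq_iff partial_commute)

text \<open>A multiset forgets the order of differentiation, and its \<open>sum_mset\<close> serves
  as the weight in the reduction below.\<close>

definition partials :: "nat multiset \<Rightarrow> mpoly \<Rightarrow> mpoly" where
  "partials M \<phi> = fold_mset partial \<phi> M"

lemma partials_empty [simp]: "partials {#} \<phi> = \<phi>"
  by (simp add: partials_def)

lemma partials_add_mset [simp]: "partials (add_mset i M) \<phi> = partial i (partials M \<phi>)"
  by (simp add: partials_def)

lemma partials_add_mset': "partials (add_mset i M) \<phi> = partials M (partial i \<phi>)"
  by (simp add: partials_def partial.fold_mset_fun_left_comm)

lemma partials_union: "partials (M + N) \<phi> = partials M (partials N \<phi>)"
  by (induction M) auto

lemma partials_diff: "partials M (p - q) = partials M p - partials M q"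
  by (induction M) (auto simp: partial_diff)

lemma partials_0 [simp]: "partials M 0 = 0"
  by (induction M) auto

lemma partials_partial: "partials M (partial i \<phi>) = partial i (partials M \<phi>)"
  by (simp flip: partials_add_mset')

lemma partials_replicate: "partials (replicate_mset n i) \<phi> = (partial i ^^ n) \<phi>"
  by (induction n) auto

lemma homogeneous_partials:
  "homogeneous r (d + size M) \<phi> \<Longrightarrow> homogeneous r d (partials M \<phi>)"
  by (induction M arbitrary: d) (auto intro: homogeneous_partial)

lemma eq_0_if_partials_0:
  assumes "homogeneous r d \<phi>"
    and "\<And>M. size M = d \<Longrightarrow> set_mset M \<subseteq> {1..r} \<Longrightarrow> partials M \<phi> = 0"
  shows "\<phi> = 0"
  using assms
proof (induction d arbitrary: \<phi>)
  case 0
  from 0(2)[of "{#}"] show ?case by simp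
next
  case (Suc d)
  show ?case
  proof (rule homogeneous_eq_0_if_partials_0[OF Suc.prems(1)])
    fix i assume "i \<in> {1..r}"
    show "partial i \<phi> = 0"
    proof (rule Suc.IH[OF homogeneous_partial[OF Suc.prems(1)]])
      fix M :: "nat multiset" assume "size M = d" "set_mset M \<subseteq> {1..r}"
      with \<open>i \<in> {1..r}\<close> show "partials M (partial i \<phi>) = 0"
        using Suc.prems(2)[of "add_mset i M"] by (simp add: partials_partial)
    qed
  qed
qed

text \<open>Every term of the expanded product other than the leading one replaces some \<open>l\<close> by some
  \<open>j > l\<close> in the multiset of differentiation variables, so it increases the sum of the multiset.\<close>

lemma diff_ops_leading_term:
  assumes "set js \<subseteq> {l<..r}" "l \<in> {1..r}" "set_mset B \<subseteq> {1..r}"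
    and "\<And>G. size G = size B + length js \<Longrightarrow> set_mset G \<subseteq> {1..r} \<Longrightarrow>
           sum_mset B + length js * l < sum_mset G \<Longrightarrow> partials G \<phi> = 0"
  shows "diff_ops l js (partials B \<phi>) = partials (B + replicate_mset (length js) l) \<phi>"
  using assms
proof (induction js arbitrary: B rule: rev_induct)
  case Nil
  then show ?case by simp
next
  \<comment> \<open>\<open>foldr\<close> applies the last factor first, hence the induction from the
    right. That factor splits into an \<open>l\<close>-branch, which continues the leading term, and
    a \<open>j\<close>-branch, whose weight is too large to survive.\<close>
  case (snoc j js)
  have j: "l < j" "j \<in> {1..r}" using snoc.prems(1,2) by auto
  have 1: "diff_ops l js (partials (add_mset l B) \<phi>)
        = partials (add_mset l B + replicate_mset (length js) l) \<phi>"
    using snoc.prems by (intro snoc.IH) (auto simp: algebra_simps)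
  have 2: "diff_ops l js (partials (add_mset j B) \<phi>)
        = partials (add_mset j B + replicate_mset (length js) l) \<phi>"
    using snoc.prems j by (intro snoc.IH) (auto simp: algebra_simps)
  have 3: "partials (add_mset j B + replicate_mset (length js) l) \<phi> = 0"
    using snoc.prems(2,3) j
    by (intro snoc.prems(4)) (auto simp: sum_mset_replicate_mset)
  show ?case
    using 1 2 3 by (simp add: diff_ops_diff)
qed

text \<open>The order of \<open>flow_operator r m l\<close> as a differential operator; equally the
  number of edges leaving vertex \<open>l\<close>, counted with multiplicity.\<close>

definition operator_order :: "nat \<Rightarrow> (nat \<Rightarrow> nat \<Rightarrow> nat) \<Rightarrow> nat \<Rightarrow> nat" where
  "operator_order r m l = (\<Sum>j=l+1..r+1. m l j)"

lemma length_concat_replicate: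
  "length (concat (map (\<lambda>j. replicate (m l j) j) [l+1..<r+1])) = (\<Sum>j=l+1..<r+1. m l j)"
  by (simp add: length_concat o_def sum_list_distinct_conv_sum_set)

text \<open>If some \<open>l\<close> occurs too often in \<open>M\<close>, the \<open>l\<close>-th
  operator divides out its leading term: modulo derivatives of larger weight, already known to
  vanish, \<open>partials M \<phi>\<close> is a derivative of that operator applied to
  \<open>\<phi>\<close>, hence 0. The weight \<open>sum_mset M\<close> is at most
  \<open>r * d\<close>, so the induction is well-founded.\<close>

lemma eq_0_if_reduced_partials_0:
  assumes hom: "homogeneous r d \<phi>" and sol: "solves_flow_system r m \<phi>"
    and red: "\<And>M. size M = d \<Longrightarrow> set_mset M \<subseteq> {1..r} \<Longrightarrow>
           (\<And>l. l \<in> {1..r} \<Longrightarrow> count M l < operator_order r m l) \<Longrightarrow> partials M \<phi> = 0"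
  shows "\<phi> = 0"
proof (rule eq_0_if_partials_0[OF hom])
  fix M :: "nat multiset" assume "size M = d" "set_mset M \<subseteq> {1..r}"
  then show "partials M \<phi> = 0"
  proof (induction "r * d - sum_mset M" arbitrary: M rule: less_induct)
    case less
    have le: "sum_mset G \<le> r * size G" if "set_mset G \<subseteq> {1..r}" for G
      using that by (induction G) auto
    have IH: "partials G \<phi> = 0"
      if "size G = d" "set_mset G \<subseteq> {1..r}" "sum_mset M < sum_mset G" for G
      using less.hyps[of G] le[of G] that by simp
    show ?case
    proof (cases "\<forall>l\<in>{1..r}. count M l < operator_order r m l")
      case True
      with red less.prems show ?thesis by blast
    next
      case False
      then obtain l where l: "l \<in> {1..r}" "operator_order r m l \<le> count M l"
        by (meson not_less)
      define js where "js = concat (map (\<lambda>j. replicate (m l j) j) [l+1..<r+1])"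
      define B where "B = M - replicate_mset (operator_order r m l) l"
      have M: "M = B + replicate_mset (operator_order r m l) l"
        unfolding B_def using l(2) by (simp add: count_le_replicate_mset_subset_eq)
      have e: "{l + 1..r + 1} = insert (r + 1) {l + 1..<r + 1}" using l(1) by auto
      have ord: "operator_order r m l = length js + m l (r + 1)"
        unfolding js_def operator_order_def length_concat_replicate using l(1)
        by (simp only: e sum.insert finite_atLeastLessThan atLeastLessThan_iff less_irrefl simp_thms
              not_False_eq_True)
      have js: "set js \<subseteq> {l<..r}" by (auto simp: js_def)
      \<comment> \<open>The factor \<open>partial l ^^ m l (r + 1)\<close> carries no difference;
        \<open>B'\<close> absorbs it, leaving exactly \<open>length js\<close> copies of
        \<open>l\<close> for the linear factors.\<close>
      define B' where "B' = B + replicate_mset (m l (r + 1)) l"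
      have M': "M = B' + replicate_mset (length js) l"
        unfolding M B'_def ord by (intro multiset_eqI, auto)
      have "partials M \<phi> = diff_ops l js (partials B' \<phi>)"
        unfolding M'
      proof (rule diff_ops_leading_term[symmetric, OF js l(1)])
        show "set_mset B' \<subseteq> {1..r}" using less.prems(2) unfolding M' by auto
        fix G assume "size G = size B' + length js" "set_mset G \<subseteq> {1..r}"
          "sum_mset B' + length js * l < sum_mset G"
        then show "partials G \<phi> = 0"
          using less.prems(1) unfolding M' by (intro IH) (auto simp: M' sum_mset_replicate_mset)
      qed
      also have "\<dots> = partials B (diff_ops l js ((partial l ^^ m l (r + 1)) \<phi>))"
      proof -
        have "partials B (diff_ops l js \<psi>) = diff_ops l js (partials B \<psi>)" for js \<psi>
          by (induction js) (auto simp: partials_diff partials_partial)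
        then show ?thesis by (simp add: B'_def partials_union partials_replicate)
      qed
      also have "\<dots> = 0"
        using sol l(1) by (simp add: solves_flow_system_def flow_operator_eq_diff_ops js_def)
      finally show ?thesis .
    qed
  qed
qed

section \<open>Counting reduced exponents\<close>

lemma num_coords_eq: "num_coords r m = (\<Sum>l=1..r. operator_order r m l)"
proof -
  have "{(i, j). 1 \<le> i \<and> i < j \<and> j \<le> r + 1} = (SIGMA i:{1..r}. {i+1..r+1})" by auto
  then show ?thesis
    unfolding num_coords_def operator_order_def by (simp only:) (rule sum.Sigma[symmetric], auto)
qed

text \<open>It spans the socle of the quotient of the ring of differential operators by the system.\<close>

definition top_mset :: "nat \<Rightarrow> (nat \<Rightarrow> nat \<Rightarrow> nat) \<Rightarrow> nat multiset" where
  "top_mset r m = (\<Sum>l=1..r. replicate_mset (operator_order r m l - 1) l)"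

lemma count_top_mset:
  "count (top_mset r m) l = (if l \<in> {1..r} then operator_order r m l - 1 else 0)"
  by (auto simp: top_mset_def count_sum sum.delta)

lemma operator_order_pos:
  assumes "\<And>i j. 1 \<le> i \<Longrightarrow> i < j \<Longrightarrow> j \<le> r + 1 \<Longrightarrow> 0 < m i j" "l \<in> {1..r}"
  shows "0 < operator_order r m l"
proof -
  have "0 < m l (r + 1)" using assms by auto
  also have "m l (r + 1) \<le> operator_order r m l"
    unfolding operator_order_def using assms(2) by (intro member_le_sum) auto
  finally show ?thesis .
qed

lemma size_eq_sum_count: "set_mset (M :: nat multiset) \<subseteq> {1..r} \<Longrightarrow> size M = (\<Sum>l=1..r. count M l)"
  unfolding size_multiset_overloaded_eq
  by (rule sum.mono_neutral_left) (auto simp: not_in_iff)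

lemma sum_operator_order:
  assumes "\<And>i j. 1 \<le> i \<Longrightarrow> i < j \<Longrightarrow> j \<le> r + 1 \<Longrightarrow> 0 < m i j"
  shows "(\<Sum>l=1..r. operator_order r m l - 1) = num_coords r m - r"
proof -
  \<comment> \<open>Adding 1 to each summand undoes the truncated subtraction, since all orders are
    positive.\<close>
  have "(\<Sum>l=1..r. operator_order r m l - 1) + r = (\<Sum>l=1..r. operator_order r m l - 1 + 1)"
    unfolding sum.distrib by simp
  also have "\<dots> = (\<Sum>l=1..r. operator_order r m l)"
    using operator_order_pos[of r m] assms by (intro sum.cong) (auto simp: Suc_le_eq)
  finally show ?thesis by (simp add: num_coords_eq)
qed

text \<open>Each multiplicity is at most the order minus 1, and these bounds add up to
  \<open>num_coords r m - r\<close>; equality of the sums forces equality of every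
  multiplicity.\<close>

lemma reduced_mset:
  assumes pos: "\<And>i j. 1 \<le> i \<Longrightarrow> i < j \<Longrightarrow> j \<le> r + 1 \<Longrightarrow> 0 < m i j"
    and M: "set_mset M \<subseteq> {1..r}" "\<And>l. l \<in> {1..r} \<Longrightarrow> count M l < operator_order r m l"
  shows "size M \<le> num_coords r m - r"
    and "size M = num_coords r m - r \<Longrightarrow> M = top_mset r m"
proof -
  have le: "count M l \<le> operator_order r m l - 1" if "l \<in> {1..r}" for l
    using M(2)[OF that] by simp
  have s: "(\<Sum>l=1..r. operator_order r m l - 1) = num_coords r m - r"
    by (intro sum_operator_order pos)
  show "size M \<le> num_coords r m - r"
    unfolding size_eq_sum_count[OF M(1)] s[symmetric] by (intro sum_mono le)
  assume "size M = num_coords r m - r"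
  then have eq: "(\<Sum>l=1..r. count M l) = (\<Sum>l=1..r. operator_order r m l - 1)"
    unfolding size_eq_sum_count[OF M(1)] s .
  have "count M l = operator_order r m l - 1" if "l \<in> {1..r}" for l
    using sum_mono_inv[OF eq le that] by simp
  moreover have "count M l = 0" if "l \<notin> {1..r}" for l
    using that M(1) by (meson not_in_iff subsetD)
  ultimately show "M = top_mset r m"
    by (intro multiset_eqI) (auto simp: count_top_mset)
qed

text \<open>No reduced multiset has size above \<open>num_coords r m - r\<close>, so the condition
  on reduced derivatives holds vacuously.\<close>

lemma solution_large_degree_eq_0:
  assumes "\<And>i j. 1 \<le> i \<Longrightarrow> i < j \<Longrightarrow> j \<le> r + 1 \<Longrightarrow> 0 < m i j"
    and "homogeneous r d \<phi>" "solves_flow_system r m \<phi>" "num_coords r m - r < d"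
  shows "\<phi> = 0"
  using assms reduced_mset(1)[of r m]
  by (intro eq_0_if_reduced_partials_0[OF assms(2,3)]) (meson not_le)

lemma partials_const_mult:
  "partials M (const_mpoly c * p) = const_mpoly c * partials M p"
  by (induction M) (auto simp: partial_const_mult)

text \<open>In degree \<open>num_coords r m - r\<close> only one reduced derivative remains, and its
  value is a constant. It is thus an injective linear functional on the solutions, whose space has
  dimension at most 1.\<close>

lemma top_solution_unique:
  assumes pos: "\<And>i j. 1 \<le> i \<Longrightarrow> i < j \<Longrightarrow> j \<le> r + 1 \<Longrightarrow> 0 < m i j"
    and \<phi>: "homogeneous r (num_coords r m - r) \<phi>" "solves_flow_system r m \<phi>"
    and v: "homogeneous r (num_coords r m - r) v" "solves_flow_system r m v" "v \<noteq> 0"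
  shows "\<exists>c. \<phi> = const_mpoly c * v"
proof -
  let ?T = "top_mset r m"
  let ?D = "num_coords r m - r"
  have T: "size ?T = ?D"
  proof -
    have "set_mset ?T \<subseteq> {1..r}"
      by (auto simp: count_top_mset simp flip: count_greater_zero_iff split: if_splits)
    then have "size ?T = (\<Sum>l=1..r. operator_order r m l - 1)"
      by (simp add: size_eq_sum_count count_top_mset)
    also have "\<dots> = ?D" by (intro sum_operator_order pos)
    finally show ?thesis .
  qed
  have key: "\<psi> = 0" if "homogeneous r ?D \<psi>" "solves_flow_system r m \<psi>" "partials ?T \<psi> = 0" for \<psi>
    using reduced_mset(2)[of r m] pos that(3)
    by (intro eq_0_if_reduced_partials_0[OF that(1,2)]) metis
  have const: "Poly_Mapping.lookup (partials ?T \<psi>) \<alpha> = 0"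
    if "homogeneous r ?D \<psi>" "\<alpha> \<noteq> 0" for \<psi> \<alpha>
    using homogeneous_partials[of r 0 ?T \<psi>] that exp_degree_eq_0_iff[of \<alpha>] T
      homogeneousD(2)[of r 0 "partials ?T \<psi>" \<alpha>] by auto
  define t where "t = Poly_Mapping.lookup (partials ?T v) 0"
  have "t \<noteq> 0"
  proof
    assume "t = 0"
    then have "partials ?T v = 0"
      using const[OF v(1)] by (intro poly_mapping_eqI) (metis t_def lookup_zero)
    with key v show False by blast
  qed
  \<comment> \<open>Chosen so that the top derivatives of the two solutions cancel.\<close>
  define c where "c = Poly_Mapping.lookup (partials ?T \<phi>) 0 / t"
  have "\<phi> - const_mpoly c * v = 0"
  proof (rule key)
    show "homogeneous r ?D (\<phi> - const_mpoly c * v)"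
      using \<phi> v by (intro homogeneous_diff homogeneous_const_mult)
    have "flow_operator r m l (const_mpoly c * v) = 0" if "l \<in> {1..r}" for l
    proof -
      have "flow_operator r m l (const_mpoly c * v) = const_mpoly c * flow_operator r m l v"
        by (rule flow_operator_commute[symmetric]) (auto simp: partial_const_mult right_diff_distrib)
      with v(2) that show ?thesis by (simp add: solves_flow_system_def)
    qed
    with \<phi>(2) show "solves_flow_system r m (\<phi> - const_mpoly c * v)"
      by (simp add: solves_flow_system_def flow_operator_diff)
    show "partials ?T (\<phi> - const_mpoly c * v) = 0"
    proof (rule poly_mapping_eqI)
      fix \<alpha>
      show "Poly_Mapping.lookup (partials ?T (\<phi> - const_mpoly c * v)) \<alpha> = Poly_Mapping.lookup 0 \<alpha>"
        using const[OF \<phi>(1), of \<alpha>] const[OF v(1), of \<alpha>] \<open>t \<noteq> 0\<close>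
        by (cases "\<alpha> = 0") (auto simp: partials_diff partials_const_mult lookup_minus
              lookup_const_mult c_def t_def)
    qed
  qed
  then show ?thesis by (metis eq_iff_diff_eq_0)
qed

section \<open>The volume polynomial as a solution\<close>

text \<open>The head of the list is the outermost integration. \<open>length cs\<close> is the
  degree of the integrand, so the series in \<open>edge_int\<close> is long enough; parallel edges
  each contribute one integration, whatever their label \<open>k\<close>.\<close>

fun vol_poly :: "coord list \<Rightarrow> mpoly" where
  "vol_poly [] = 1"
| "vol_poly ((l, j, k) # cs) = edge_int l j (length cs) (vol_poly cs)"

lemma homogeneous_vol_poly:
  "fst ` set cs \<subseteq> {1..r} \<Longrightarrow> homogeneous r (length cs) (vol_poly cs)"
  by (induction cs rule: vol_poly.induct) (auto intro: homogeneous_edge_int)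

lemma diff_vol_poly:
  assumes "fst ` set cs \<subseteq> {1..r}" "l \<noteq> j"
  shows "partial l (vol_poly ((l, j, k) # cs)) - partial j (vol_poly ((l, j, k) # cs)) = vol_poly cs"
  using diff_edge_int[OF homogeneous_vol_poly[OF assms(1)], of j l] assms(2) by simp

text \<open>Each integration has a left inverse by \<open>diff_vol_poly\<close>, so the nonzero
  constant at the core cannot be annihilated.\<close>

lemma vol_poly_nonzero:
  assumes "\<And>i j k. (i, j, k) \<in> set cs \<Longrightarrow> i \<in> {1..r} \<and> i < j"
  shows "vol_poly cs \<noteq> 0"
  using assms
proof (induction cs rule: vol_poly.induct)
  case 1
  then show ?case by simp
next
  case (2 l j k cs)
  have "fst ` set cs \<subseteq> {1..r}" using "2.prems" by force
  moreover have "l \<noteq> j" using "2.prems"[of l j k] by auto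
  ultimately have "partial l (vol_poly ((l, j, k) # cs)) - partial j (vol_poly ((l, j, k) # cs)) = vol_poly cs"
    by (rule diff_vol_poly)
  moreover have "vol_poly cs \<noteq> 0" using "2.prems" by (intro "2.IH") auto
  ultimately show ?case by fastforce
qed

text \<open>The derivative passes through all integrations with other sources and reaches the
  constant 1.\<close>

lemma partial_vol_poly_eq_0:
  "l \<notin> fst ` set cs \<Longrightarrow> partial l (vol_poly cs) = 0"
  by (induction cs rule: vol_poly.induct) (auto simp: partial_edge_int_commute)

text \<open>The coordinates \<open>(i, r + 1, 1)\<close> are left out: they are determined by the other ones.\<close>

definition free_block :: "nat \<Rightarrow> (nat \<Rightarrow> nat \<Rightarrow> nat) \<Rightarrow> nat \<Rightarrow> coord list" where
  "free_block r m l =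
     map (\<lambda>k. (l, r + 1, k)) [2..<m l (r + 1) + 1] @
     concat (map (\<lambda>j. map (\<lambda>k. (l, j, k)) [1..<m l j + 1]) (rev [l + 1..<r + 1]))"

text \<open>Sources increase along the list, so larger sources are integrated first. Within a block
  the edges to \<open>r + 1\<close> come first and the other targets decrease, which is the order in
  which \<open>flow_operator\<close> removes its factors.\<close>

definition free_coords :: "nat \<Rightarrow> (nat \<Rightarrow> nat \<Rightarrow> nat) \<Rightarrow> coord list" where
  "free_coords r m = concat (map (free_block r m) [1..<r + 1])"

lemma set_free_block:
  "set (free_block r m l) = {(i, j, k). i = l \<and> ((j = r + 1 \<and> 2 \<le> k \<and> k \<le> m l j) \<or>
      (l < j \<and> j \<le> r \<and> 1 \<le> k \<and> k \<le> m l j))}"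
  unfolding free_block_def by (auto simp: image_iff)

lemma set_free_coords:
  "set (free_coords r m) = flow_coords r m - (\<lambda>i. (i, r + 1, 1)) ` {1..r}"
  unfolding free_coords_def set_concat set_map image_image UN_simps
  by (auto simp: set_free_block flow_coords_def image_iff)

lemma distinct_concat_map:
  assumes "distinct xs" "\<And>x. x \<in> set xs \<Longrightarrow> distinct (f x)"
    and "\<And>x y. x \<in> set xs \<Longrightarrow> y \<in> set xs \<Longrightarrow> x \<noteq> y \<Longrightarrow> set (f x) \<inter> set (f y) = {}"
  shows "distinct (concat (map f xs))"
  using assms by (induction xs) fastforce+

lemma distinct_free_coords: "distinct (free_coords r m)"
proof -
  have "distinct (free_block r m l)" for l
  proof -
    have "distinct (concat (map (\<lambda>j. map (\<lambda>k. (l, j, k)) [1..<m l j + 1]) (rev [l + 1..<r + 1])))"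
      by (rule distinct_concat_map) (auto simp: distinct_map inj_on_def)
    then show ?thesis
      unfolding free_block_def by (auto simp: distinct_map inj_on_def)
  qed
  then show ?thesis
    unfolding free_coords_def by (intro distinct_concat_map) (auto simp: set_free_block)
qed

lemma length_free_coords:
  assumes "\<And>i j. 1 \<le> i \<Longrightarrow> i < j \<Longrightarrow> j \<le> r + 1 \<Longrightarrow> 0 < m i j"
  shows "length (free_coords r m) = num_coords r m - r"
proof -
  have "length (free_block r m l) = operator_order r m l - 1" if "l \<in> {1..r}" for l
  proof -
    have "{l + 1..r + 1} = insert (r + 1) {l + 1..<r + 1}" using that by auto
    moreover have "0 < m l (r + 1)" using assms that by auto
    ultimately show ?thesis
      by (simp add: free_block_def operator_order_def length_concat o_def rev_map[symmetric]
            sum_list_distinct_conv_sum_set del: upt_Suc)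
  qed
  moreover have "set [1..<r + 1] = {1..r}" by auto
  ultimately have "length (free_coords r m) = (\<Sum>l=1..r. operator_order r m l - 1)"
    by (simp add: free_coords_def length_concat o_def sum_list_distinct_conv_sum_set
        del: set_upt)
  also have "\<dots> = num_coords r m - r" by (intro sum_operator_order assms)
  finally show ?thesis .
qed

section \<open>Operators strip edges from the volume polynomial\<close>

lemma diff_funpow_vol_poly:
  assumes "fst ` set cs \<subseteq> {1..r}" "l \<in> {1..r}" "l \<noteq> j"
  shows "((\<lambda>p. partial l p - partial j p) ^^ length ks) (vol_poly (map (\<lambda>k. (l, j, k)) ks @ cs)) = vol_poly cs"
proof (induction ks)
  case (Cons k ks)
  have "fst ` set (map (\<lambda>k. (l, j, k)) ks @ cs) \<subseteq> {1..r}" using assms by auto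
  from diff_vol_poly[OF this assms(3), of k] Cons show ?case
    by (simp add: funpow_swap1 del: vol_poly.simps funpow.simps) (simp add: funpow_Suc_right del: vol_poly.simps funpow.simps)
qed simp

text \<open>An edge into \<open>r + 1\<close> is inverted by
  \<open>partial l - partial (r + 1)\<close>, and \<open>partial (r + 1)\<close> is 0 on polynomials
  in the variables \<open>1\<close> to \<open>r\<close>.\<close>

lemma partial_funpow_vol_poly:
  assumes "fst ` set cs \<subseteq> {1..r}" "l \<in> {1..r}"
  shows "(partial l ^^ length ks) (vol_poly (map (\<lambda>k. (l, r + 1, k)) ks @ cs)) = vol_poly cs"
proof (induction ks)
  case (Cons k ks)
  have 1: "fst ` set (map (\<lambda>k. (l, r + 1, k)) ks @ cs) \<subseteq> {1..r}"
    and 2: "fst ` set (map (\<lambda>k. (l, r + 1, k)) (k # ks) @ cs) \<subseteq> {1..r}" using assms by auto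
  have "partial (r + 1) (vol_poly (map (\<lambda>k. (l, r + 1, k)) (k # ks) @ cs)) = 0"
    by (rule partial_outside[OF homogeneous_vol_poly[OF 2]]) simp
  with diff_vol_poly[OF 1, of l "r + 1" k] assms(2)
  have "partial l (vol_poly (map (\<lambda>k. (l, r + 1, k)) (k # ks) @ cs)) = vol_poly (map (\<lambda>k. (l, r + 1, k)) ks @ cs)"
    by (simp del: vol_poly.simps)
  with Cons show ?case
    by (simp add: funpow_Suc_right del: vol_poly.simps funpow.simps)
qed simp

text \<open>The operator strips the whole block and still has one \<open>partial l\<close> left,
  which kills the remaining polynomial because all its sources exceed \<open>l\<close>.\<close>

lemma flow_operator_free_block:
  assumes l: "l \<in> {1..r}" and m: "0 < m l (r + 1)" and cs: "fst ` set cs \<subseteq> {l<..r}"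
  shows "flow_operator r m l (vol_poly (free_block r m l @ cs)) = 0"
proof -
  have cs': "fst ` set cs \<subseteq> {1..r}" using cs l by fastforce
  let ?b = "\<lambda>j. map (\<lambda>k. (l, j, k)) [1..<m l j + 1]"
  let ?D = "\<lambda>j. (\<lambda>p. partial l p - partial j p) ^^ m l j"
  \<comment> \<open>The inner \<open>foldr\<close> acts on the outer edges: the last target in
    \<open>js\<close> is removed first, matching the reversed order in the block.\<close>
  have A: "foldr ?D js (vol_poly (concat (map ?b (rev js)) @ cs')) = vol_poly cs'"
    if "fst ` set cs' \<subseteq> {1..r}" "set js \<subseteq> {l<..}" for js cs'
    using that
  proof (induction js arbitrary: cs')
    case (Cons j js)
    have "foldr ?D js (vol_poly (concat (map ?b (rev js)) @ (?b j @ cs'))) = vol_poly (?b j @ cs')"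
      using Cons.prems l by (intro Cons.IH) auto
    moreover have "?D j (vol_poly (?b j @ cs')) = vol_poly cs'"
      using diff_funpow_vol_poly[of cs' r l j "[1..<m l j + 1]"] Cons.prems l by auto
    ultimately show ?case by simp
  qed simp
  let ?js = "[l + 1..<r + 1]"
  let ?rest = "concat (map ?b (rev ?js)) @ cs"
  have "partial l (foldr ?D js p) = foldr ?D js (partial l p)" for js p
  proof -
    have "partial l (((\<lambda>p. partial l p - partial j p) ^^ n) p) =
       ((\<lambda>p. partial l p - partial j p) ^^ n) (partial l p)" for j n p
      by (induction n) (auto simp: partial_diff partial_commute[of l j])
    then show ?thesis by (induction js) auto
  qed
  note comm = this
  \<comment> \<open>The labels \<open>k\<close> start at 2, so this list is one shorter than the
    power of \<open>partial l\<close>; the surplus derivative is then moved outside.\<close>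
  have "flow_operator r m l (vol_poly (free_block r m l @ cs))
      = foldr ?D ?js ((partial l ^^ Suc (length [2..<m l (r + 1) + 1])) (vol_poly (free_block r m l @ cs)))"
    using m by (simp add: flow_operator_def)
  also have "\<dots> = foldr ?D ?js (partial l ((partial l ^^ length [2..<m l (r + 1) + 1]) (vol_poly (free_block r m l @ cs))))"
    by simp
  also have "(partial l ^^ length [2..<m l (r + 1) + 1]) (vol_poly (free_block r m l @ cs)) = vol_poly ?rest"
    unfolding free_block_def append_assoc using cs' l
    by (intro partial_funpow_vol_poly) auto
  also have "foldr ?D ?js (partial l (vol_poly ?rest)) = partial l (foldr ?D ?js (vol_poly ?rest))"
    by (rule comm[symmetric])
  also have "foldr ?D ?js (vol_poly ?rest) = vol_poly cs"
    by (rule A[OF cs']) auto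
  also have "partial l (vol_poly cs) = 0"
    using cs by (intro partial_vol_poly_eq_0) auto
  finally show ?thesis .
qed

text \<open>Integrations with source below \<open>l\<close> commute with every derivative in the
  \<open>l\<close>-th operator.\<close>

lemma flow_operator_append_eq_0:
  assumes "flow_operator r m l (vol_poly cs) = 0" "fst ` set cs' \<subseteq> {..<l}"
  shows "flow_operator r m l (vol_poly (cs' @ cs)) = 0"
  using assms(2)
proof (induction cs')
  case (Cons c cs')
  obtain i j k where c: "c = (i, j, k)" by (cases c)
  let ?J = "edge_int i j (length (cs' @ cs))"
  have "flow_operator r m l (?J (vol_poly (cs' @ cs))) = ?J (flow_operator r m l (vol_poly (cs' @ cs)))"
    using Cons.prems c
    by (intro flow_operator_commute[symmetric]) (auto simp: edge_int_diff partial_edge_int_commute)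
  with Cons c show ?case by simp
qed (use assms(1) in simp)

lemma solves_vol_poly:
  assumes "\<And>i j. 1 \<le> i \<Longrightarrow> i < j \<Longrightarrow> j \<le> r + 1 \<Longrightarrow> 0 < m i j"
  shows "solves_flow_system r m (vol_poly (free_coords r m))"
  unfolding solves_flow_system_def
proof
  fix l assume l: "l \<in> {1..r}"
  let ?c = "\<lambda>ls. concat (map (free_block r m) ls)"
  have "[1..<r + 1] = [1..<l] @ l # [l + 1..<r + 1]"
    using l upt_add_eq_append[of 1 l "r + 1 - l"] by (simp add: upt_conv_Cons)
  \<comment> \<open>Smaller sources are outer integrations, through which the operator passes;
    larger sources lie inside block \<open>l\<close> and do not involve the variable
    \<open>l\<close>.\<close>
  then have eq: "free_coords r m = ?c [1..<l] @ (free_block r m l @ ?c [l + 1..<r + 1])"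
    by (simp add: free_coords_def)
  have "0 < m l (r + 1)" using assms l by auto
  then have "flow_operator r m l (vol_poly (free_block r m l @ ?c [l + 1..<r + 1])) = 0"
    using l by (intro flow_operator_free_block) (auto simp: set_free_block)
  then show "flow_operator r m l (vol_poly (free_coords r m)) = 0"
    unfolding eq by (rule flow_operator_append_eq_0) (auto simp: set_free_block)
qed

lemma fst_free_coords: "fst ` set (free_coords r m) \<subseteq> {1..r}"
  by (auto simp: set_free_coords flow_coords_def)

text \<open>Descending induction from the top degree: a nonzero solution of positive degree has a
  nonzero partial derivative, again a solution.\<close>

lemma exists_solution:
  assumes pos: "\<And>i j. 1 \<le> i \<Longrightarrow> i < j \<Longrightarrow> j \<le> r + 1 \<Longrightarrow> 0 < m i j"
    and d: "d \<le> num_coords r m - r"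
  shows "\<exists>\<phi>. \<phi> \<noteq> 0 \<and> homogeneous r d \<phi> \<and> solves_flow_system r m \<phi>"
  using d
proof (induction rule: inc_induct)
  case base
  have "vol_poly (free_coords r m) \<noteq> 0"
    by (rule vol_poly_nonzero[of _ r]) (auto simp: set_free_coords flow_coords_def)
  then show ?case
    using homogeneous_vol_poly[OF fst_free_coords, of r m] solves_vol_poly[of r m] pos
      length_free_coords[of r m]
    by metis
next
  case (step n)
  then obtain \<phi> where \<phi>: "\<phi> \<noteq> 0" "homogeneous r (Suc n) \<phi>" "solves_flow_system r m \<phi>" by blast
  then obtain i where "partial i \<phi> \<noteq> 0" using homogeneous_eq_0_if_partials_0 by blast
  with \<phi> show ?case
    by (intro exI[of _ "partial i \<phi>"]) (auto intro: homogeneous_partial solves_flow_system_partial)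
qed

section \<open>The fibre measures\<close>

abbreviation lborel_on :: "'i set \<Rightarrow> ('i \<Rightarrow> real) measure" where
  "lborel_on S \<equiv> \<Pi>\<^sub>M i\<in>S. lborel"

interpretation lborel_prod: product_sigma_finite "\<lambda>_. lborel :: real measure"
  by standard

lemma space_lborel_on: "space (lborel_on S) = S \<rightarrow>\<^sub>E UNIV"
  by (simp add: space_PiM)

text \<open>The preimage of a box is a box with relabelled and translated sides. With
  \<open>g\<close> the identity this is translation invariance; with \<open>g = fst\<close> it
  passes from vertices to tree edges.\<close>

lemma distr_lborel_on_reindex_shift:
  fixes g :: "'j \<Rightarrow> 'i"
  assumes fin: "finite I" and g: "bij_betw g J I"
  shows "distr (lborel_on I) (lborel_on J) (\<lambda>x. \<lambda>j\<in>J. x (g j) + c j) = lborel_on J"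
proof -
  have finJ: "finite J" using g fin by (simp add: bij_betw_finite)
  let ?T = "\<lambda>x. \<lambda>j\<in>J. x (g j) + c j :: real"
  have gI: "g j \<in> I" if "j \<in> J" for j using g that by (auto simp: bij_betw_def)
  have T: "?T \<in> measurable (lborel_on I) (lborel_on J)"
  proof (rule measurable_restrict)
    fix j assume "j \<in> J"
    have "(\<lambda>x. x (g j)) \<in> borel_measurable (lborel_on I)"
      using measurable_component_singleton[OF gI[OF \<open>j \<in> J\<close>], of "\<lambda>_. lborel"] by simp
    then show "(\<lambda>x. x (g j) + c j) \<in> measurable (lborel_on I) lborel" by simp
  qed
  show ?thesis
  proof (rule lborel_prod.PiM_eqI[OF finJ])
    fix A :: "'j \<Rightarrow> real set" assume A: "\<And>j. j \<in> J \<Longrightarrow> A j \<in> sets lborel"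
    define h where "h = the_inv_into J g"
    have hg: "h (g j) = j" if "j \<in> J" for j
      using g that by (simp add: h_def bij_betw_def the_inv_into_f_f)
    let ?A = "\<lambda>j. {x. x + c j \<in> A j}"
    have Aj: "?A j \<in> sets lborel" "emeasure lborel (?A j) = emeasure lborel (A j)" if "j \<in> J" for j
    proof -
      have eq: "?A j = (\<lambda>x. c j + x) -` A j \<inter> space lborel" by (auto simp: add.commute)
      show "?A j \<in> sets lborel"
        unfolding eq using A[OF that] by (intro measurable_sets[of _ lborel borel]) auto
      show "emeasure lborel (?A j) = emeasure lborel (A j)"
        unfolding eq using A[OF that]
        by (subst emeasure_distr[symmetric, of _ lborel borel]) (auto simp: lborel_distr_plus)
    qed
    have "?T -` (Pi\<^sub>E J A) \<inter> space (lborel_on I) = Pi\<^sub>E I (\<lambda>i. ?A (h i))"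
    proof (intro set_eqI)
      fix x
      have "(\<forall>i\<in>I. x i \<in> ?A (h i)) \<longleftrightarrow> (\<forall>j\<in>J. x (g j) + c j \<in> A j)"
        using g hg by (auto simp: bij_betw_def)
      then show "x \<in> ?T -` (Pi\<^sub>E J A) \<inter> space (lborel_on I) \<longleftrightarrow> x \<in> Pi\<^sub>E I (\<lambda>i. ?A (h i))"
        by (auto simp: space_lborel_on PiE_iff)
    qed
    then have "emeasure (distr (lborel_on I) (lborel_on J) ?T) (Pi\<^sub>E J A)
        = emeasure (lborel_on I) (Pi\<^sub>E I (\<lambda>i. ?A (h i)))"
      using A T finJ by (subst emeasure_distr) (auto intro!: sets_PiM_I_finite)
    also have "\<dots> = (\<Prod>i\<in>I. emeasure lborel (?A (h i)))"
      using g hg Aj(1) by (intro lborel_prod.emeasure_PiM fin) (auto simp: bij_betw_def)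
    also have "\<dots> = (\<Prod>j\<in>J. emeasure lborel (?A (h (g j))))"
      by (rule prod.reindex_bij_betw[OF g, symmetric])
    also have "\<dots> = (\<Prod>j\<in>J. emeasure lborel (A j))"
      using hg Aj(2) by (intro prod.cong) auto
    finally show "emeasure (distr (lborel_on I) (lborel_on J) ?T) (Pi\<^sub>E J A)
        = (\<Prod>j\<in>J. emeasure lborel (A j))" .
  qed simp
qed

text \<open>The coordinates of \<open>flow_map\<close> for an arbitrary set of edges, so that edges
  can be split off.\<close>

definition net_outflow :: "coord set \<Rightarrow> (coord \<Rightarrow> real) \<Rightarrow> nat \<Rightarrow> real" where
  "net_outflow S y v = (\<Sum>(i, j, k)\<in>S. y (i, j, k) * (of_bool (i = v) - of_bool (j = v)))"

lemma net_outflow_cong: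
  "(\<And>e. e \<in> S \<Longrightarrow> y e = z e) \<Longrightarrow> net_outflow S y v = net_outflow S z v"
  unfolding net_outflow_def by (rule sum.cong) auto

lemma net_outflow_add:
  "net_outflow S (\<lambda>e. y e + z e) v = net_outflow S y v + net_outflow S z v"
  by (simp add: net_outflow_def sum.distrib[symmetric] algebra_simps case_prod_unfold)

lemma measurable_component_lborel_on:
  "e \<in> S \<Longrightarrow> (\<lambda>y. y e) \<in> borel_measurable (lborel_on S)"
  using measurable_component_singleton[of e S "\<lambda>_. lborel"] by simp

lemma measurable_net_outflow:
  assumes "S \<subseteq> T"
  shows "(\<lambda>y. net_outflow S y v) \<in> borel_measurable (lborel_on T)"
  unfolding net_outflow_def case_prod_unfold using assms
  by (intro borel_measurable_sum borel_measurable_times borel_measurable_const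
        measurable_component_lborel_on) auto

text \<open>The sum condition determines the last coordinate, extensionality the values outside
  \<open>{1..r + 1}\<close>.\<close>

lemma V_space_eqI:
  assumes "a \<in> V_space r" "b \<in> V_space r" "\<And>i. i \<in> {1..r} \<Longrightarrow> a i = b i"
  shows "a = b"
proof
  fix v
  have "(\<Sum>i=1..r. a i) = (\<Sum>i=1..r. b i)" by (rule sum.cong) (use assms in auto)
  moreover have "(\<Sum>i=1..r. a i) + a (r + 1) = 0" "(\<Sum>i=1..r. b i) + b (r + 1) = 0"
    using assms(1,2) by (simp_all add: V_space_def)
  ultimately have r: "a (r + 1) = b (r + 1)" by linarith
  have ext: "a \<in> extensional {1..r + 1}" "b \<in> extensional {1..r + 1}"
    using assms(1,2) by (simp_all add: V_space_def PiE_def)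
  consider "v \<in> {1..r}" | "v = r + 1" | "v \<notin> {1..r + 1}" by fastforce
  then show "a v = b v"
    by cases (use assms(3) r extensional_arb[OF ext(1)] extensional_arb[OF ext(2)] in auto)
qed

lemma V_vec_simps:
  "i \<in> {1..r} \<Longrightarrow> V_vec r a i = a i" "V_vec r a (r + 1) = - (\<Sum>i=1..r. a i)"
proof -
  assume i: "i \<in> {1..r}"
  then have "V_vec r a i = (\<Sum>p=1..r. a p * (basis_vec r p i - basis_vec r (r + 1) i))"
    by (simp add: V_vec_def)
  also have "\<dots> = (\<Sum>p=1..r. if p = i then a p else 0)"
    using i by (intro sum.cong) (auto simp: basis_vec_def)
  also have "\<dots> = a i" using i by (simp add: sum.delta)
  finally show "V_vec r a i = a i" .
next
  have "V_vec r a (r + 1) = (\<Sum>i=1..r. a i * (basis_vec r i (r + 1) - basis_vec r (r + 1) (r + 1)))"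
    by (simp add: V_vec_def)
  also have "\<dots> = (\<Sum>i=1..r. a i * (0 - 1))"
    by (intro sum.cong) (auto simp: basis_vec_def)
  finally have "V_vec r a (r + 1) = (\<Sum>i=1..r. a i * (0 - 1))" .
  then show "V_vec r a (r + 1) = - (\<Sum>i=1..r. a i)" by (simp add: sum_negf)
qed

lemma V_vec_in_V_space: "V_vec r a \<in> V_space r"
proof -
  have "(\<Sum>i=1..r. V_vec r a i) = (\<Sum>i=1..r. a i)"
    by (rule sum.cong) (auto simp: V_vec_simps)
  then show ?thesis
    using V_vec_simps(2)[of r a] by (auto simp: V_space_def V_vec_def)
qed

lemma measurable_V_vec [measurable]: "V_vec r \<in> measurable (lborel_on {1..r}) (lborel_on {1..r + 1})"
  unfolding V_vec_def
proof (rule measurable_restrict)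
  fix v
  have "(\<lambda>a. \<Sum>i=1..r. a i * (basis_vec r i v - basis_vec r (r + 1) v)) \<in> borel_measurable (lborel_on {1..r})"
    by (intro borel_measurable_sum borel_measurable_times borel_measurable_const
        measurable_component_lborel_on)
  then show "(\<lambda>a. \<Sum>i=1..r. a i * (basis_vec r i v - basis_vec r (r + 1) v)) \<in> measurable (lborel_on {1..r}) lborel"
    by simp
qed

lemma sets_V_lebesgue [simp]: "sets (V_lebesgue r) = sets (lborel_on {1..r + 1})"
  by (simp add: V_lebesgue_def)

lemma AE_V_lebesgue: "AE a in V_lebesgue r. a \<in> V_space r"
proof -
  have "{a \<in> space (lborel_on {1..r + 1}). a \<in> V_space r}
      = {a \<in> space (lborel_on {1..r + 1}). (\<Sum>i=1..r+1. a i) = 0}"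
    by (auto simp: V_space_def space_lborel_on)
  also have "\<dots> \<in> sets (lborel_on {1..r + 1})"
  proof -
    have [measurable]: "(\<lambda>a. \<Sum>i=1..r+1. a i) \<in> borel_measurable (lborel_on {1..r + 1})"
      by (intro borel_measurable_sum measurable_component_lborel_on)
    show ?thesis by measurable
  qed
  finally show ?thesis
    unfolding V_lebesgue_def by (subst AE_distr_iff[OF measurable_V_vec]) (auto simp: V_vec_in_V_space)
qed

section \<open>Fibres parametrised by the free coordinates\<close>

context
  fixes r :: nat and m :: "nat \<Rightarrow> nat \<Rightarrow> nat"
  assumes pos: "\<And>i j. 1 \<le> i \<Longrightarrow> i < j \<Longrightarrow> j \<le> r + 1 \<Longrightarrow> 0 < m i j"
begin

abbreviation coords where "coords \<equiv> flow_coords r m"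
abbreviation free where "free \<equiv> set (free_coords r m)"
abbreviation tree :: "coord set" where "tree \<equiv> (\<lambda>i. (i, r + 1, 1)) ` {1..r}"

lemma coords_eq: "coords = free \<union> tree" "free \<inter> tree = {}"
proof -
  have "tree \<subseteq> coords"
  proof clarify
    fix i assume "i \<in> {1..r}"
    then show "(i, r + 1, 1) \<in> coords" using pos[of i "r + 1"] by (simp add: flow_coords_def)
  qed
  then show "coords = free \<union> tree" "free \<inter> tree = {}" by (auto simp: set_free_coords)
qed

lemma free_subset: "free \<subseteq> coords"
  by (simp add: coords_eq(1))

lemma net_outflow_coords:
  assumes "i \<in> {1..r}"
  shows "net_outflow coords y i = net_outflow free y i + y (i, r + 1, 1)"
proof -
  have "net_outflow coords y i = net_outflow free y i + net_outflow tree y i"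
    unfolding net_outflow_def coords_eq(1) by (rule sum.union_disjoint) (use coords_eq(2) in auto)
  also have "net_outflow tree y i = (\<Sum>p\<in>{1..r}. y (p, r + 1, 1) * (of_bool (p = i) - of_bool (r + 1 = i)))"
    unfolding net_outflow_def by (subst sum.reindex) (auto simp: inj_on_def)
  also have "\<dots> = (\<Sum>p\<in>{1..r}. if p = i then y (p, r + 1, 1) else 0)"
    using assms by (intro sum.cong) auto
  also have "\<dots> = y (i, r + 1, 1)" using assms by (simp add: sum.delta)
  finally show ?thesis .
qed

lemma flow_map_eq: "v \<in> {1..r + 1} \<Longrightarrow> flow_map r m y v = net_outflow coords y v"
  unfolding flow_map_def net_outflow_def
  by (auto intro!: sum.cong simp: basis_vec_def flow_coords_def)

lemma flow_map_in_V_space: "flow_map r m y \<in> V_space r"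
proof -
  have "(\<Sum>v=1..r+1. flow_map r m y v) = (\<Sum>v=1..r+1. net_outflow coords y v)"
    by (rule sum.cong) (simp_all add: flow_map_eq del: sum.cl_ivl_Suc)
  also have "\<dots> = (\<Sum>(i, j, k)\<in>coords. \<Sum>v=1..r+1. y (i, j, k) * (of_bool (i = v) - of_bool (j = v)))"
    unfolding net_outflow_def by (subst sum.swap) (simp add: case_prod_unfold del: sum.cl_ivl_Suc)
  also have "\<dots> = 0"
  proof (rule sum.neutral, clarify)
    fix i j k assume "(i, j, k) \<in> coords"
    then have ij: "i \<in> {1..r+1}" "j \<in> {1..r+1}" by (auto simp: flow_coords_def)
    have "(\<Sum>v=1..r+1. y (i, j, k) * (of_bool (i = v) - of_bool (j = v)))
        = y (i, j, k) * ((\<Sum>v=1..r+1. of_bool (i = v)) - (\<Sum>v=1..r+1. of_bool (j = v)))"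
      by (simp only: sum_distrib_left sum_subtractf right_diff_distrib)
    also have "(\<Sum>v=1..r+1. of_bool (i = v)) = (1::real)" if "i \<in> {1..r+1}" for i
      using that by (simp add: of_bool_def sum.delta' del: sum.cl_ivl_Suc)
    note this[OF ij(1)]
    also have "(\<Sum>v=1..r+1. of_bool (j = v)) = (1::real)"
      using ij(2) by (simp add: of_bool_def sum.delta' del: sum.cl_ivl_Suc)
    finally show "(\<Sum>v=1..r+1. y (i, j, k) * (of_bool (i = v) - of_bool (j = v))) = 0" by simp
  qed
  finally show ?thesis by (auto simp: V_space_def flow_map_def)
qed

text \<open>Points of \<open>V_space r\<close> are determined by their first \<open>r\<close>
  coordinates, and the \<open>i\<close>-th equation contains exactly one tree coordinate, with
  coefficient 1.\<close>

lemma flow_map_eq_iff: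
  assumes "a \<in> V_space r"
  shows "flow_map r m y = a \<longleftrightarrow> (\<forall>i\<in>{1..r}. y (i, r + 1, 1) = a i - net_outflow free y i)"
proof -
  have "flow_map r m y = a \<longleftrightarrow> (\<forall>i\<in>{1..r}. flow_map r m y i = a i)"
    using V_space_eqI[OF flow_map_in_V_space assms] by auto
  then show ?thesis by (auto simp: flow_map_eq net_outflow_coords)
qed

text \<open>For a tree edge \<open>e\<close>, \<open>fst e\<close> is the vertex whose flow equation
  determines the coordinate \<open>e\<close>.\<close>

definition fibre_section :: "(nat \<Rightarrow> real) \<Rightarrow> (coord \<Rightarrow> real) \<Rightarrow> coord \<Rightarrow> real" where
  "fibre_section a k = (\<lambda>e\<in>coords. if e \<in> free then k e else a (fst e) - net_outflow free k (fst e))"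

lemma fibre_section_simps:
  "e \<in> free \<Longrightarrow> fibre_section a k e = k e"
  "i \<in> {1..r} \<Longrightarrow> fibre_section a k (i, r + 1, 1) = a i - net_outflow free k i"
proof -
  show "e \<in> free \<Longrightarrow> fibre_section a k e = k e" using free_subset by (auto simp: fibre_section_def)
  assume "i \<in> {1..r}"
  then have "(i, r + 1, 1) \<in> tree" by auto
  then show "fibre_section a k (i, r + 1, 1) = a i - net_outflow free k i"
    using coords_eq by (auto simp: fibre_section_def)
qed

lemma flow_map_fibre_section:
  assumes "a \<in> V_space r"
  shows "flow_map r m (fibre_section a k) = a"
proof -
  have "net_outflow free (fibre_section a k) i = net_outflow free k i" for i
    by (rule net_outflow_cong) (rule fibre_section_simps(1))
  then show ?thesis
    unfolding flow_map_eq_iff[OF assms] by (intro ballI) (simp only: fibre_section_simps(2))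
qed

lemma measurable_fibre_section_pair:
  "(\<lambda>(a, k). fibre_section a k) \<in> measurable (lborel_on {1..r + 1} \<Otimes>\<^sub>M lborel_on free) (lborel_on coords)"
  unfolding fibre_section_def case_prod_unfold
proof (rule measurable_restrict)
  fix e assume e: "e \<in> coords"
  show "(\<lambda>x. if e \<in> free then snd x e else fst x (fst e) - net_outflow free (snd x) (fst e))
        \<in> measurable (lborel_on {1..r + 1} \<Otimes>\<^sub>M lborel_on free) lborel"
  proof (cases "e \<in> free")
    case True
    have "(\<lambda>x. snd x e) \<in> borel_measurable (lborel_on {1..r + 1} \<Otimes>\<^sub>M lborel_on free)"
      by (rule measurable_compose[OF measurable_snd measurable_component_lborel_on[OF True]])
    with True show ?thesis by simp
  next
    case False
    have v: "fst e \<in> {1..r + 1}" using e by (auto simp: flow_coords_def)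
    have "(\<lambda>x. fst x (fst e) - net_outflow free (snd x) (fst e))
        \<in> borel_measurable (lborel_on {1..r + 1} \<Otimes>\<^sub>M lborel_on free)"
      by (intro borel_measurable_diff measurable_compose[OF measurable_fst measurable_component_lborel_on[OF v]]
           measurable_compose[OF measurable_snd measurable_net_outflow]) simp
    with False show ?thesis by simp
  qed
qed

lemma measurable_fibre_section [measurable]:
  "fibre_section a \<in> measurable (lborel_on free) (lborel_on coords)"
  unfolding fibre_section_def
proof (rule measurable_restrict)
  fix e
  have [measurable]: "(\<lambda>k. k e) \<in> borel_measurable (lborel_on free)" if "e \<in> free"
    using that by (rule measurable_component_lborel_on)
  have [measurable]: "(\<lambda>k. net_outflow free k v) \<in> borel_measurable (lborel_on free)" for v
    by (rule measurable_net_outflow) simp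
  show "(\<lambda>k. if e \<in> free then k e else a (fst e) - net_outflow free k (fst e))
        \<in> measurable (lborel_on free) lborel"
    by (cases "e \<in> free") simp_all
qed

text \<open>No Jacobian factor appears, since tree coordinates enter the flow equations with
  coefficient 1.\<close>

definition fibre_measure :: "(nat \<Rightarrow> real) \<Rightarrow> (coord \<Rightarrow> real) measure" where
  "fibre_measure a = distr (lborel_on free) (lborel_on coords) (fibre_section a)"

lemma sets_flow_map_eq:
  assumes "a \<in> V_space r"
  shows "{y \<in> space (lborel_on coords). flow_map r m y = a} \<in> sets (lborel_on coords)"
proof -
  have "(\<lambda>y. y (i, r + 1, 1)) \<in> borel_measurable (lborel_on coords)" if "i \<in> {1..r}" for i
    using that by (intro measurable_component_lborel_on) (auto simp: coords_eq(1))
  then show ?thesis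
    unfolding flow_map_eq_iff[OF assms]
    by (intro sets.sets_Collect_finite_All borel_measurable_eq borel_measurable_diff
        borel_measurable_const measurable_net_outflow[OF free_subset]) auto
qed

lemma AE_fibre_measure: "a \<in> V_space r \<Longrightarrow> AE y in fibre_measure a. flow_map r m y = a"
  unfolding fibre_measure_def
  by (subst AE_distr_iff) (auto simp: sets_flow_map_eq flow_map_fibre_section)

text \<open>In the free coordinates, translating by \<open>u\<close> is translating by the
  restriction of \<open>u\<close>, which preserves Lebesgue measure.\<close>

lemma fibre_measure_translate:
  assumes "u \<in> space (lborel_on coords)"
  shows "fibre_measure (\<lambda>i\<in>{1..r + 1}. a i + flow_map r m u i) =
         distr (fibre_measure a) (lborel_on coords) (\<lambda>y. \<lambda>e\<in>coords. y e + u e)"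
proof -
  let ?a = "\<lambda>i\<in>{1..r + 1}. a i + flow_map r m u i"
  let ?s = "\<lambda>k. \<lambda>e\<in>free. k e + u e"
  let ?t = "\<lambda>y. \<lambda>e\<in>coords. y e + u e"
  have t: "?t \<in> measurable (lborel_on coords) (lborel_on coords)"
  proof (rule measurable_restrict)
    fix e assume "e \<in> coords"
    then have [measurable]: "(\<lambda>y. y e) \<in> borel_measurable (lborel_on coords)"
      by (rule measurable_component_lborel_on)
    show "(\<lambda>y. y e + u e) \<in> measurable (lborel_on coords) lborel" by simp
  qed
  have s: "?s \<in> measurable (lborel_on free) (lborel_on free)"
  proof (rule measurable_restrict)
    fix e assume "e \<in> free"
    then have [measurable]: "(\<lambda>y. y e) \<in> borel_measurable (lborel_on free)"
      by (rule measurable_component_lborel_on)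
    show "(\<lambda>y. y e + u e) \<in> measurable (lborel_on free) lborel" by simp
  qed
  have eq: "?t (fibre_section a k) = fibre_section ?a (?s k)" for k
  proof
    fix e
    show "?t (fibre_section a k) e = fibre_section ?a (?s k) e"
    proof (cases "e \<in> coords")
      case False
      then show ?thesis by (simp add: fibre_section_def)
    next
      case True
      then consider "e \<in> free" | i where "i \<in> {1..r}" "e = (i, r + 1, 1)"
        using coords_eq(1) by auto
      then show ?thesis
      proof cases
        case 1
        then show ?thesis using True by (simp add: fibre_section_simps)
      next
        case 2
        have "net_outflow free (?s k) i = net_outflow free (\<lambda>e. k e + u e) i"
          by (rule net_outflow_cong) simp
        then show ?thesis
          using True 2(1) unfolding 2(2)
          by (simp add: fibre_section_simps[simplified] net_outflow_add flow_map_eq net_outflow_coords)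
      qed
    qed
  qed
  have "distr (fibre_measure a) (lborel_on coords) ?t
      = distr (lborel_on free) (lborel_on coords) (fibre_section ?a \<circ> ?s)"
    unfolding fibre_measure_def using t by (subst distr_distr) (auto simp: o_def eq)
  also have "\<dots> = distr (distr (lborel_on free) (lborel_on free) ?s) (lborel_on coords) (fibre_section ?a)"
    using s by (subst distr_distr) auto
  also have "distr (lborel_on free) (lborel_on free) ?s = lborel_on free"
    by (rule distr_lborel_on_reindex_shift[where g = "\<lambda>e. e"]) (auto simp: bij_betw_def)
  finally show ?thesis unfolding fibre_measure_def by (rule sym)
qed

text \<open>For fixed free coordinates the tree coordinates are a relabelled translate of
  \<open>a\<close>; the \<open>merge\<close> form is the one suited to Fubini.\<close>

lemma fibre_section_V_vec:
  assumes "k \<in> space (lborel_on free)"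
  shows "fibre_section (V_vec r a) k =
     merge free tree (k, \<lambda>e\<in>tree. a (fst e) + (- net_outflow free k (fst e)))"
proof
  fix e
  consider "e \<in> free" | "e \<in> tree" "e \<notin> free" | "e \<notin> free" "e \<notin> tree" "e \<notin> coords"
    using coords_eq by blast
  then show "fibre_section (V_vec r a) k e =
     merge free tree (k, \<lambda>e\<in>tree. a (fst e) + (- net_outflow free k (fst e))) e"
  proof cases
    case 1
    then show ?thesis by (simp add: fibre_section_simps merge_def)
  next
    case 2
    then obtain i where i: "i \<in> {1..r}" "e = (i, r + 1, 1)" by auto
    with 2 have "merge free tree (k, \<lambda>e\<in>tree. a (fst e) + (- net_outflow free k (fst e))) e
        = a i - net_outflow free k i"
      by (simp add: merge_def)
    with i show ?thesis by (simp only: fibre_section_simps V_vec_simps)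
  next
    case 3
    then show ?thesis by (simp add: fibre_section_def merge_def)
  qed
qed

text \<open>Fubini exchanges base and free coordinates; for fixed \<open>k\<close> the inner
  variable \<open>a\<close> is then replaced by the tree coordinates through a measure-preserving
  shift.\<close>

lemma fibre_measure_disintegration:
  assumes B: "B \<in> sets (lborel_on coords)"
  shows "emeasure (lborel_on coords) B = (\<integral>\<^sup>+ a. emeasure (fibre_measure a) B \<partial>V_lebesgue r)"
proof -
  interpret free: finite_product_sigma_finite "\<lambda>_. lborel" free by standard simp
  interpret base: finite_product_sigma_finite "\<lambda>_. lborel" "{1..r}" by standard simp
  interpret pair: pair_sigma_finite "lborel_on {1..r}" "lborel_on free" ..
  have em: "emeasure (fibre_measure a) B = (\<integral>\<^sup>+ k. indicator B (fibre_section a k) \<partial>lborel_on free)" for a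
  proof -
    have "emeasure (fibre_measure a) B = (\<integral>\<^sup>+ y. indicator B y \<partial>fibre_measure a)"
      using B by (subst nn_integral_indicator) (auto simp: fibre_measure_def)
    also have "\<dots> = (\<integral>\<^sup>+ k. indicator B (fibre_section a k) \<partial>lborel_on free)"
      unfolding fibre_measure_def using B by (subst nn_integral_distr) auto
    finally show ?thesis .
  qed
  have B': "indicator B \<in> borel_measurable (lborel_on coords)" using B by simp
  have joint: "(\<lambda>(a, k). indicator B (fibre_section a k) :: ennreal)
      \<in> borel_measurable (lborel_on {1..r + 1} \<Otimes>\<^sub>M lborel_on free)"
    using measurable_compose[OF measurable_fibre_section_pair B'] by (simp add: case_prod_unfold)
  have joint': "(\<lambda>(a, k). indicator B (fibre_section (V_vec r a) k) :: ennreal)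
      \<in> borel_measurable (lborel_on {1..r} \<Otimes>\<^sub>M lborel_on free)"
  proof -
    have "(\<lambda>x. (V_vec r (fst x), snd x)) \<in> measurable (lborel_on {1..r} \<Otimes>\<^sub>M lborel_on free)
        (lborel_on {1..r + 1} \<Otimes>\<^sub>M lborel_on free)" by measurable
    from measurable_compose[OF this joint] show ?thesis by (simp add: case_prod_unfold)
  qed
  have "(\<integral>\<^sup>+ a. emeasure (fibre_measure a) B \<partial>V_lebesgue r)
      = (\<integral>\<^sup>+ a. \<integral>\<^sup>+ k. indicator B (fibre_section (V_vec r a) k) \<partial>lborel_on free \<partial>lborel_on {1..r})"
    unfolding em V_lebesgue_def
    using free.borel_measurable_nn_integral[OF joint] by (subst nn_integral_distr[OF measurable_V_vec]) auto
  also have "\<dots> = (\<integral>\<^sup>+ k. \<integral>\<^sup>+ a. indicator B (fibre_section (V_vec r a) k) \<partial>lborel_on {1..r} \<partial>lborel_on free)"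
    by (rule pair.Fubini'[OF joint', symmetric])
  also have "\<dots> = (\<integral>\<^sup>+ k. \<integral>\<^sup>+ z. indicator B (merge free tree (k, z)) \<partial>lborel_on tree \<partial>lborel_on free)"
  proof (rule nn_integral_cong)
    fix k assume k: "k \<in> space (lborel_on free)"
    let ?T = "\<lambda>a. \<lambda>e\<in>tree. a (fst e) + (- net_outflow free k (fst e))"
    have bij: "bij_betw fst tree {1..r}" by (auto simp: bij_betw_def inj_on_def image_image)
    have T: "?T \<in> measurable (lborel_on {1..r}) (lborel_on tree)"
    proof (rule measurable_restrict)
      fix e assume "e \<in> tree"
      then have "(\<lambda>a. a (fst e)) \<in> borel_measurable (lborel_on {1..r})"
        by (intro measurable_component_lborel_on) auto
      then show "(\<lambda>a. a (fst e) + (- net_outflow free k (fst e))) \<in> measurable (lborel_on {1..r}) lborel"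
        unfolding measurable_lborel1 measurable_lborel2 by (intro borel_measurable_add borel_measurable_const)
    qed
    have "(\<lambda>z. (k, z)) \<in> measurable (lborel_on tree) (lborel_on free \<Otimes>\<^sub>M lborel_on tree)"
      using k by (rule measurable_Pair1')
    from measurable_compose[OF this measurable_merge]
    have "(\<lambda>z. merge free tree (k, z)) \<in> measurable (lborel_on tree) (lborel_on coords)"
      by (simp add: coords_eq(1))
    from measurable_compose[OF this B']
    have meas: "(\<lambda>z. indicator B (merge free tree (k, z)) :: ennreal) \<in> borel_measurable (lborel_on tree)" .
    have "(\<integral>\<^sup>+ a. indicator B (fibre_section (V_vec r a) k) \<partial>lborel_on {1..r})
        = (\<integral>\<^sup>+ a. indicator B (merge free tree (k, ?T a)) \<partial>lborel_on {1..r})"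
      by (simp only: fibre_section_V_vec[OF k])
    also have "\<dots> = (\<integral>\<^sup>+ z. indicator B (merge free tree (k, z)) \<partial>distr (lborel_on {1..r}) (lborel_on tree) ?T)"
      using T meas by (subst nn_integral_distr) auto
    also have "distr (lborel_on {1..r}) (lborel_on tree) ?T = lborel_on tree"
      by (rule distr_lborel_on_reindex_shift[OF _ bij]) simp
    finally show "(\<integral>\<^sup>+ a. indicator B (fibre_section (V_vec r a) k) \<partial>lborel_on {1..r})
        = (\<integral>\<^sup>+ z. indicator B (merge free tree (k, z)) \<partial>lborel_on tree)" .
  qed
  also have "\<dots> = (\<integral>\<^sup>+ y. indicator B y \<partial>lborel_on (free \<union> tree))"
    using coords_eq B' by (intro lborel_prod.product_nn_integral_fold[symmetric]) auto
  also have "\<dots> = emeasure (lborel_on coords) B"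
    using B by (simp add: coords_eq(1))
  finally show ?thesis by simp
qed

text \<open>This existence is what gives meaning to the \<open>SOME\<close> in
  \<open>quotient_measure\<close>.\<close>

lemma is_quotient_measure_fibre_measure: "is_quotient_measure r m fibre_measure"
  unfolding is_quotient_measure_def U_lebesgue_def
  using AE_fibre_measure fibre_measure_translate fibre_measure_disintegration
  by (auto simp: fibre_measure_def)

section \<open>Fibre volumes do not depend on the choice of quotient measure\<close>

definition free_cylinder :: "(coord \<Rightarrow> real) set \<Rightarrow> (coord \<Rightarrow> real) set" where
  "free_cylinder A = {y \<in> space (lborel_on coords). restrict y free \<in> A}"

lemma sets_free_cylinder:
  assumes "A \<in> sets (lborel_on free)"
  shows "free_cylinder A \<in> sets (lborel_on coords)"
proof -
  have "free_cylinder A = (\<lambda>y. restrict y free) -` A \<inter> space (lborel_on coords)"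
    by (auto simp: free_cylinder_def)
  also have "\<dots> \<in> sets (lborel_on coords)"
    by (rule measurable_sets[OF measurable_restrict_subset[OF free_subset] assms])
  finally show ?thesis .
qed

lemma V_space_0: "(\<lambda>i\<in>{1..r + 1}. 0) \<in> V_space r"
  by (auto simp: V_space_def)

text \<open>A translation changing only tree coordinates preserves every cylinder over the free
  coordinates while carrying the fibre over 0 to the fibre over \<open>a\<close>.\<close>

lemma quotient_measure_free_cylinder_translate:
  assumes \<nu>: "is_quotient_measure r m \<nu>" and A: "A \<in> sets (lborel_on free)" and a: "a \<in> V_space r"
  shows "emeasure (\<nu> a) (free_cylinder A) = emeasure (\<nu> (\<lambda>i\<in>{1..r + 1}. 0)) (free_cylinder A)"
proof -
  let ?z = "\<lambda>i\<in>{1..r + 1}. 0 :: real"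
  \<comment> \<open>Zero on the free coordinates, \<open>a i\<close> on the tree edge at
    \<open>i\<close>; its flow is \<open>a\<close>.\<close>
  define u where "u = fibre_section a (\<lambda>_. 0)"
  let ?t = "\<lambda>y. \<lambda>e\<in>coords. y e + u e"
  have u: "u \<in> space (lborel_on coords)" by (auto simp: u_def fibre_section_def space_lborel_on)
  have eq: "(\<lambda>i\<in>{1..r + 1}. ?z i + flow_map r m u i) = a"
    unfolding u_def flow_map_fibre_section[OF a] using a
    by (auto simp: V_space_def PiE_iff extensional_def)
  have "\<nu> (\<lambda>i\<in>{1..r + 1}. ?z i + flow_map r m u i) = distr (\<nu> ?z) (lborel_on coords) ?t"
    using \<nu> V_space_0 u unfolding is_quotient_measure_def U_lebesgue_def by blast
  then have d: "\<nu> a = distr (\<nu> ?z) (lborel_on coords) ?t" unfolding eq .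
  have sets: "sets (\<nu> ?z) = sets (lborel_on coords)"
    using \<nu> V_space_0 unfolding is_quotient_measure_def U_lebesgue_def by blast
  have space: "space (\<nu> ?z) = space (lborel_on coords)" using sets_eq_imp_space_eq[OF sets] .
  have "?t \<in> measurable (lborel_on coords) (lborel_on coords)"
  proof (rule measurable_restrict)
    fix e assume "e \<in> coords"
    then have [measurable]: "(\<lambda>y. y e) \<in> borel_measurable (lborel_on coords)"
      by (rule measurable_component_lborel_on)
    show "(\<lambda>y. y e + u e) \<in> measurable (lborel_on coords) lborel" by simp
  qed
  then have t: "?t \<in> measurable (\<nu> ?z) (lborel_on coords)"
    using sets by (simp cong: measurable_cong_sets)
  have "restrict (?t y) free = restrict y free" for y
    using free_subset by (auto simp: restrict_def u_def fibre_section_simps fun_eq_iff)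
  then have "?t -` free_cylinder A \<inter> space (\<nu> ?z) = free_cylinder A"
    unfolding space by (auto simp: free_cylinder_def space_lborel_on)
  then show ?thesis
    unfolding d using emeasure_distr[OF t sets_free_cylinder[OF A]] by simp
qed

text \<open>The part of the cylinder over \<open>A\<close> lying above the unit cube of \<open>V\<close> has the volume of any
  fibre of the cylinder; so this fibre volume is the same for all quotient measures.\<close>

lemma quotient_measure_cube:
  assumes \<nu>: "is_quotient_measure r m \<nu>" and A: "A \<in> sets (lborel_on free)" and a: "a \<in> V_space r"
  shows "emeasure (\<nu> a) (free_cylinder A) =
    emeasure (lborel_on coords)
      {y \<in> free_cylinder A. \<forall>i\<in>{1..r}. flow_map r m y i \<in> {0..1}}"
proof -
  define q where "q = emeasure (\<nu> (\<lambda>i\<in>{1..r + 1}. 0)) (free_cylinder A)"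
  let ?C = "{y \<in> free_cylinder A. \<forall>i\<in>{1..r}. flow_map r m y i \<in> {0..1}}"
  let ?Q = "{b \<in> space (lborel_on {1..r + 1}). \<forall>i\<in>{1..r}. b i \<in> {0..1}}"
  have C: "?C \<in> sets (lborel_on coords)"
  proof -
    have [measurable]: "(\<lambda>y. net_outflow coords y v) \<in> borel_measurable (lborel_on coords)" for v
      by (rule measurable_net_outflow) simp
    have "?C = free_cylinder A \<inter> {y \<in> space (lborel_on coords). \<forall>i\<in>{1..r}. net_outflow coords y i \<in> {0..1}}"
      by (auto simp: free_cylinder_def flow_map_eq)
    also have "\<dots> \<in> sets (lborel_on coords)"
      by (intro sets.Int sets_free_cylinder A) measurable
    finally show ?thesis .
  qed
  have Q: "?Q \<in> sets (lborel_on {1..r + 1})"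
  proof -
    have [measurable]: "(\<lambda>b. b i) \<in> borel_measurable (lborel_on {1..r + 1})" if "i \<in> {1..r}" for i
      using that by (intro measurable_component_lborel_on) auto
    show ?thesis by measurable
  qed
  \<comment> \<open>Over the cube the condition defining \<open>?C\<close> holds almost everywhere
    on the fibre, elsewhere almost nowhere; so the fibre measure is the constant \<open>q\<close> or
    0.\<close>
  have fib: "emeasure (\<nu> b) ?C = q * indicator ?Q b" if b: "b \<in> V_space r" for b
  proof -
    have sets: "sets (\<nu> b) = sets (lborel_on coords)"
      and AE: "AE y in \<nu> b. flow_map r m y = b"
      using \<nu> b unfolding is_quotient_measure_def U_lebesgue_def by blast+
    show ?thesis
    proof (cases "b \<in> ?Q")
      case True
      have "emeasure (\<nu> b) ?C = emeasure (\<nu> b) (free_cylinder A)"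
        using AE True C sets_free_cylinder[OF A] by (intro emeasure_eq_AE) (auto simp: sets)
      also have "\<dots> = q"
        unfolding q_def by (rule quotient_measure_free_cylinder_translate[OF \<nu> A b])
      finally show ?thesis using True by simp
    next
      case False
      then have nQ: "\<not> (\<forall>i\<in>{1..r}. b i \<in> {0..1})"
        using b by (auto simp: V_space_def space_lborel_on)
      have "emeasure (\<nu> b) ?C = emeasure (\<nu> b) {}"
        using AE C by (intro emeasure_eq_AE) (use nQ in \<open>auto simp: sets\<close>)
      then show ?thesis using False by simp
    qed
  qed
  have "emeasure (lborel_on coords) ?C = (\<integral>\<^sup>+ b. emeasure (\<nu> b) ?C \<partial>V_lebesgue r)"
    using \<nu> C unfolding is_quotient_measure_def U_lebesgue_def by blast
  also have "\<dots> = (\<integral>\<^sup>+ b. q * indicator ?Q b \<partial>V_lebesgue r)"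
    by (intro nn_integral_cong_AE eventually_mono[OF AE_V_lebesgue] fib)
  also have "\<dots> = q * emeasure (V_lebesgue r) ?Q"
    using Q by (intro nn_integral_cmult_indicator) simp
  \<comment> \<open>The lattice normalisation of \<open>da\<close> enters here: the cube pulls back
    to the unit box, of measure 1.\<close>
  also have "emeasure (V_lebesgue r) ?Q = emeasure (lborel_on {1..r}) (Pi\<^sub>E {1..r} (\<lambda>_. {0..1}))"
  proof -
    have "V_vec r -` ?Q \<inter> space (lborel_on {1..r}) = Pi\<^sub>E {1..r} (\<lambda>_. {0..1})"
    proof (rule set_eqI)
      fix x :: "nat \<Rightarrow> real"
      have "V_vec r x \<in> space (lborel_on {1..r + 1})" by (simp add: space_lborel_on V_vec_def)
      moreover have "(\<forall>i\<in>{1..r}. V_vec r x i \<in> {0..1}) \<longleftrightarrow> (\<forall>i\<in>{1..r}. x i \<in> {0..1})"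
        by (rule ball_cong) (simp_all only: V_vec_simps(1))
      ultimately show "x \<in> V_vec r -` ?Q \<inter> space (lborel_on {1..r}) \<longleftrightarrow> x \<in> Pi\<^sub>E {1..r} (\<lambda>_. {0..1})"
        by (simp only: vimage_eq Int_iff mem_Collect_eq space_lborel_on PiE_iff UNIV_I ball_simps simp_thms)
           blast
    qed
    then show ?thesis
      unfolding V_lebesgue_def using Q by (subst emeasure_distr[OF measurable_V_vec]) auto
  qed
  also have "\<dots> = 1" by (subst lborel_prod.emeasure_PiM) auto
  finally show ?thesis
    using quotient_measure_free_cylinder_translate[OF \<nu> A a] by (simp add: q_def)
qed

text \<open>The right-hand side of \<open>quotient_measure_cube\<close> does not mention
  \<open>\<nu>\<close>, so \<open>\<nu>\<close> may be replaced by the explicit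
  \<open>fibre_measure\<close>.\<close>

lemma quotient_measure_free_cylinder:
  assumes \<nu>: "is_quotient_measure r m \<nu>" and A: "A \<in> sets (lborel_on free)" and a: "a \<in> V_space r"
  shows "emeasure (\<nu> a) (free_cylinder A) = emeasure (lborel_on free) A"
proof -
  have "emeasure (\<nu> a) (free_cylinder A) = emeasure (fibre_measure a) (free_cylinder A)"
    using quotient_measure_cube[OF \<nu> A a] quotient_measure_cube[OF is_quotient_measure_fibre_measure A a]
    by simp
  also have "\<dots> = emeasure (lborel_on free) (fibre_section a -` free_cylinder A \<inter> space (lborel_on free))"
    unfolding fibre_measure_def by (rule emeasure_distr[OF measurable_fibre_section sets_free_cylinder[OF A]])
  also have "fibre_section a -` free_cylinder A \<inter> space (lborel_on free) = A"
  proof -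
    have "restrict (fibre_section a k) free = k" if "k \<in> space (lborel_on free)" for k
      using that by (auto simp: fibre_section_simps space_lborel_on PiE_iff extensional_def restrict_def fun_eq_iff)
    moreover have "fibre_section a k \<in> space (lborel_on coords)" for k
      by (auto simp: fibre_section_def space_lborel_on)
    ultimately show ?thesis
      using sets.sets_into_space[OF A] by (auto simp: free_cylinder_def)
  qed
  finally show ?thesis .
qed

end

text \<open>The slack in the \<open>i\<close>-th inequality is the eliminated coordinate
  \<open>(i, r + 1, 1)\<close>.\<close>

definition slack_polytope :: "nat \<Rightarrow> coord set \<Rightarrow> (nat \<Rightarrow> real) \<Rightarrow> (coord \<Rightarrow> real) set" where
  "slack_polytope r S a =
     {k \<in> space (lborel_on S). (\<forall>e\<in>S. 0 \<le> k e) \<and> (\<forall>i\<in>{1..r}. net_outflow S k i \<le> a i)}"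

lemma sets_slack_polytope:
  assumes "finite S"
  shows "slack_polytope r S a \<in> sets (lborel_on S)"
proof -
  have [measurable]: "(\<lambda>y. net_outflow S y v) \<in> borel_measurable (lborel_on S)" for v
    by (rule measurable_net_outflow) simp
  have [measurable]: "(\<lambda>b. b e) \<in> borel_measurable (lborel_on S)" if "e \<in> S" for e
    using that by (rule measurable_component_lborel_on)
  show ?thesis unfolding slack_polytope_def using assms by measurable
qed

text \<open>On the fibre over \<open>a\<close> the flow polytope coincides with the cylinder over
  the slack polytope, and the quotient measure at \<open>a\<close> is concentrated on that
  fibre.\<close>

lemma flow_volume_eq:
  assumes pos: "\<And>i j. 1 \<le> i \<Longrightarrow> i < j \<Longrightarrow> j \<le> r + 1 \<Longrightarrow> 0 < m i j"
    and a: "a \<in> V_space r"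
  shows "flow_volume r m a =
    measure (lborel_on (set (free_coords r m))) (slack_polytope r (set (free_coords r m)) a)"
proof -
  let ?free = "set (free_coords r m)" and ?coords = "flow_coords r m"
  let ?\<nu> = "quotient_measure r m"
  let ?A = "slack_polytope r ?free a"
  note [simp] = pos
  have \<nu>: "is_quotient_measure r m ?\<nu>"
    unfolding quotient_measure_def
    by (rule someI[of "is_quotient_measure r m", OF is_quotient_measure_fibre_measure]) simp
  have sets: "sets (?\<nu> a) = sets (lborel_on ?coords)"
    and AE: "AE y in ?\<nu> a. flow_map r m y = a"
    using \<nu> a unfolding is_quotient_measure_def U_lebesgue_def by blast+
  have iff: "y \<in> flow_polytope r m a \<longleftrightarrow> y \<in> free_cylinder r m ?A"
    if "y \<in> space (lborel_on ?coords)" "flow_map r m y = a" for y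
  proof -
    have tree: "\<forall>i\<in>{1..r}. y (i, r + 1, 1) = a i - net_outflow ?free y i"
      using \<open>flow_map r m y = a\<close> flow_map_eq_iff[of r m, OF _ a] by simp
    have "?coords = ?free \<union> (\<lambda>i. (i, r + 1, 1)) ` {1..r}"
      by (rule coords_eq) simp
    then have "(\<forall>e\<in>?coords. 0 \<le> y e) \<longleftrightarrow>
        (\<forall>e\<in>?free. 0 \<le> y e) \<and> (\<forall>i\<in>{1..r}. 0 \<le> y (i, r + 1, 1))"
      by (simp only: ball_Un ball_simps)
    also have "(\<forall>i\<in>{1..r}. 0 \<le> y (i, r + 1, 1)) \<longleftrightarrow> (\<forall>i\<in>{1..r}. net_outflow ?free y i \<le> a i)"
      by (rule ball_cong) (simp_all only: tree[rule_format] diff_ge_0_iff_ge)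
    also have "net_outflow ?free y = net_outflow ?free (restrict y ?free)"
      by (rule ext, rule net_outflow_cong) simp
    finally show ?thesis
      using that by (auto simp: flow_polytope_def free_cylinder_def slack_polytope_def space_lborel_on)
  qed
  have P: "flow_polytope r m a \<in> sets (lborel_on ?coords)"
  proof -
    have "flow_polytope r m a = {y \<in> space (lborel_on ?coords). flow_map r m y = a} \<inter> free_cylinder r m ?A"
      using iff by (auto simp: flow_polytope_def space_lborel_on)
    also have "\<dots> \<in> sets (lborel_on ?coords)"
      by (intro sets.Int sets_flow_map_eq a sets_free_cylinder sets_slack_polytope) auto
    finally show ?thesis .
  qed
  have "measure (?\<nu> a) (flow_polytope r m a) = measure (?\<nu> a) (free_cylinder r m ?A)"
    using AE iff P sets_eq_imp_space_eq[OF sets] sets_free_cylinder[of r m, OF _ sets_slack_polytope]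
    by (intro measure_eq_AE) (auto simp: sets elim!: AE_mp)
  also have "\<dots> = measure (lborel_on ?free) ?A"
    unfolding measure_def
    by (subst quotient_measure_free_cylinder[OF _ \<nu> sets_slack_polytope a]) auto
  finally show ?thesis by (simp add: flow_volume_def)
qed

section \<open>The volume polynomial computes the volume\<close>

lemma sorted_free_coords: "sorted (map fst (free_coords r m))"
proof -
  have "sorted (map fst (concat (map (free_block r m) xs)))" if "sorted xs" for xs
    using that
  proof (induction xs)
    case (Cons l xs)
    have "map fst (free_block r m l) = replicate (length (free_block r m l)) l"
      unfolding replicate_length_same[symmetric] map_replicate_const[symmetric]
      by (auto simp: set_free_block)
    then have "sorted (map fst (free_block r m l))" by (simp del: length_map)
    with Cons show ?case by (auto simp: sorted_append set_free_block)
  qed simp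
  then show ?thesis by (simp add: free_coords_def)
qed

lemma DERIV_eval_edge:
  assumes "homogeneous r d p"
  shows "((\<lambda>t. eval_mpoly (\<lambda>i. a i + t * (of_bool (i = j) - of_bool (i = l))) p) has_real_derivative
     - eval_mpoly (\<lambda>i. a i + t * (of_bool (i = j) - of_bool (i = l))) (partial l p - partial j p)) (at t)"
proof -
  let ?z = "\<lambda>i. a i + t * (of_bool (i = j) - of_bool (i = l))"
  \<comment> \<open>Adjoining \<open>j\<close> and \<open>l\<close> makes both delta sums collapse,
    also when \<open>j = r + 1\<close>.\<close>
  let ?K = "{1..r} \<union> {j, l}"
  have "((\<lambda>t. eval_mpoly (\<lambda>i. a i + t * (of_bool (i = j) - of_bool (i = l))) p) has_real_derivative
     (\<Sum>i\<in>?K. (of_bool (i = j) - of_bool (i = l)) * eval_mpoly ?z (partial i p))) (at t)"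
    using assms by (intro DERIV_eval_mpoly) (auto simp: homogeneous_def)
  also have "(\<Sum>i\<in>?K. (of_bool (i = j) - of_bool (i = l)) * eval_mpoly ?z (partial i p))
    = (\<Sum>i\<in>?K. if i = j then eval_mpoly ?z (partial i p) else 0)
    - (\<Sum>i\<in>?K. if i = l then eval_mpoly ?z (partial i p) else 0)"
    unfolding sum_subtractf[symmetric] by (rule sum.cong) auto
  also have "\<dots> = eval_mpoly ?z (partial j p) - eval_mpoly ?z (partial l p)"
    by (subst (1 2) sum.delta) auto
  also have "\<dots> = - eval_mpoly ?z (partial l p - partial j p)"
    by (simp add: eval_mpoly_diff)
  finally show ?thesis .
qed

text \<open>Sending \<open>t\<close> units along the edge moves \<open>t\<close> units of supply
  from vertex \<open>l\<close> to vertex \<open>j\<close>.\<close>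

lemma slack_polytope_insert:
  assumes "finite S" "(l, j, n) \<notin> S" "x \<in> space (lborel_on S)"
  shows "x((l, j, n) := t) \<in> slack_polytope r (insert (l, j, n) S) a \<longleftrightarrow>
     0 \<le> t \<and> x \<in> slack_polytope r S (\<lambda>i. a i + t * (of_bool (i = j) - of_bool (i = l)))"
proof -
  let ?e = "(l, j, n)"
  have net: "net_outflow (insert ?e S) (x(?e := t)) i =
      t * (of_bool (l = i) - of_bool (j = i)) + net_outflow S x i" for i
  proof -
    have "net_outflow S (x(?e := t)) i = net_outflow S x i"
      using assms(2) by (intro net_outflow_cong) auto
    then show ?thesis
      unfolding net_outflow_def using assms(1,2) by simp
  qed
  have nonneg: "(\<forall>e\<in>insert ?e S. 0 \<le> (x(?e := t)) e) \<longleftrightarrow> 0 \<le> t \<and> (\<forall>e\<in>S. 0 \<le> x e)"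
    using assms(2) by auto
  have space: "x(?e := t) \<in> space (lborel_on (insert ?e S))"
    using assms(3) by (auto simp: space_lborel_on PiE_iff extensional_def)
  have bound: "t * (of_bool (l = i) - of_bool (j = i)) + c \<le> a i \<longleftrightarrow>
      c \<le> a i + t * (of_bool (i = j) - of_bool (i = l))" for i c
    by (auto simp: algebra_simps)
  show ?thesis
    unfolding slack_polytope_def mem_Collect_eq net nonneg bound using space assms(3) by blast
qed

text \<open>No coordinate of \<open>cs\<close> enters the vertex \<open>l\<close>, so the slice is empty once \<open>t > a\<^sub>l\<close>.\<close>

lemma emeasure_slack_polytope:
  assumes "distinct cs" "sorted (map fst cs)"
    and "\<And>i j k. (i, j, k) \<in> set cs \<Longrightarrow> i \<in> {1..r} \<and> i < j"
    and "\<And>i. i \<in> {1..r} \<Longrightarrow> 0 \<le> a i"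
  shows "0 \<le> eval_mpoly a (vol_poly cs) \<and>
    emeasure (lborel_on (set cs)) (slack_polytope r (set cs) a) = ennreal (eval_mpoly a (vol_poly cs))"
  using assms
proof (induction cs arbitrary: a rule: vol_poly.induct)
  case 1
  have "slack_polytope r {} a = {\<lambda>_. undefined}"
    using 1(4) by (auto simp: slack_polytope_def space_lborel_on net_outflow_def)
  then show ?case by (simp add: eval_mpoly_def)
next
  case (2 l j n cs)
  let ?e = "(l, j, n)" and ?S = "set cs"
  let ?v = "vol_poly cs" and ?w = "vol_poly ((l, j, n) # cs)"
  define z where "z = (\<lambda>t i. a i + t * (of_bool (i = j) - of_bool (i = l)))"
  have lj: "l \<in> {1..r}" "l < j" using "2.prems"(3)[of l j n] by auto
  have e: "?e \<notin> ?S" using "2.prems"(1) by simp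
  have src: "fst ` ?S \<subseteq> {1..r}" using "2.prems"(3) by force
  have src': "fst ` set ((l, j, n) # cs) \<subseteq> {1..r}" using src lj(1) by auto
  \<comment> \<open>On this interval the supply at \<open>l\<close> stays nonnegative, and the only
    other change is an increase at \<open>j\<close>.\<close>
  have IH: "0 \<le> eval_mpoly (z t) ?v"
      "emeasure (lborel_on ?S) (slack_polytope r ?S (z t)) = ennreal (eval_mpoly (z t) ?v)"
    if "0 \<le> t" "t \<le> a l" for t
  proof -
    have "0 \<le> z t i" if "i \<in> {1..r}" for i
      using "2.prems"(4)[OF that] \<open>0 \<le> t\<close> \<open>t \<le> a l\<close> lj by (auto simp: z_def)
    then show "0 \<le> eval_mpoly (z t) ?v"
      "emeasure (lborel_on ?S) (slack_polytope r ?S (z t)) = ennreal (eval_mpoly (z t) ?v)"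
      using "2.IH"[of "z t"] "2.prems"(1-3) by auto
  qed
  have empty: "slack_polytope r ?S (z t) = {}" if "a l < t" for t
  proof (rule ccontr)
    assume "slack_polytope r ?S (z t) \<noteq> {}"
    then obtain x where x: "\<forall>e\<in>?S. 0 \<le> x e" "net_outflow ?S x l \<le> z t l"
      using lj(1) by (auto simp: slack_polytope_def)
    have nonneg: "0 \<le> net_outflow ?S x l"
      unfolding net_outflow_def
    proof (rule sum_nonneg, clarify)
      fix p q k assume pq: "(p, q, k) \<in> ?S"
      then have "l \<le> p" "p < q" using "2.prems"(2,3) by force+
      then show "0 \<le> x (p, q, k) * (of_bool (p = l) - of_bool (q = l))"
        using x(1) pq by auto
    qed
    have "z t l = a l - t" using lj by (simp add: z_def)
    with nonneg x(2) that show False by simp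
  qed
  \<comment> \<open>By \<open>diff_vol_poly\<close>, \<open>?w\<close> decreases along the edge
    direction at the rate of the slice volume, so its negative is the antiderivative for the
    integral over \<open>t\<close>.\<close>
  have der: "((\<lambda>t. - eval_mpoly (z t) ?w) has_real_derivative eval_mpoly (z t) ?v) (at t)" for t
    using DERIV_minus[OF DERIV_eval_edge[OF homogeneous_vol_poly[OF src'], of a j l t]]
      diff_vol_poly[OF src, of l j n] lj(2)
    by (simp add: z_def del: vol_poly.simps)
  have meas: "(\<lambda>t. eval_mpoly (z t) ?v) \<in> borel_measurable borel"
  proof (rule borel_measurable_continuous_onI)
    show "continuous_on UNIV (\<lambda>t. eval_mpoly (z t) ?v)"
      using DERIV_eval_edge[OF homogeneous_vol_poly[OF src], of a j l]
      unfolding z_def by (intro DERIV_continuous_on) (auto intro: has_field_derivative_at_within)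
  qed
  have al: "0 \<le> a l" by (rule "2.prems"(4)[OF lj(1)])
  \<comment> \<open>Coordinate \<open>l\<close> of \<open>z (a l)\<close> is 0, where an
    \<open>edge_int\<close> with source \<open>l\<close> vanishes.\<close>
  have end0: "eval_mpoly (z (a l)) ?w = 0"
    using lj(2) by (simp add: z_def eval_mpoly_edge_int)
  have z0: "z 0 = a" by (simp add: z_def fun_eq_iff)
  have G: "slack_polytope r (insert ?e ?S) a \<in> sets (lborel_on (insert ?e ?S))"
    by (rule sets_slack_polytope) simp
  have "emeasure (lborel_on (insert ?e ?S)) (slack_polytope r (insert ?e ?S) a)
      = (\<integral>\<^sup>+ y. indicator (slack_polytope r (insert ?e ?S) a) y \<partial>lborel_on (insert ?e ?S))"
    using G by simp
  also have "\<dots> = (\<integral>\<^sup>+ t. \<integral>\<^sup>+ x. indicator (slack_polytope r (insert ?e ?S) a) (x(?e := t)) \<partial>lborel_on ?S \<partial>lborel)"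
    using G e by (intro lborel_prod.product_nn_integral_insert_rev) auto
  also have "\<dots> = (\<integral>\<^sup>+ t. ennreal (eval_mpoly (z t) ?v) * indicator {0..a l} t \<partial>lborel)"
  proof (rule nn_integral_cong)
    fix t :: real
    have "(\<integral>\<^sup>+ x. indicator (slack_polytope r (insert ?e ?S) a) (x(?e := t)) \<partial>lborel_on ?S)
        = (\<integral>\<^sup>+ x. indicator {0..} t * indicator (slack_polytope r ?S (z t)) x \<partial>lborel_on ?S)"
      using slack_polytope_insert[OF _ e]
      by (intro nn_integral_cong) (auto simp: z_def indicator_def)
    also have "\<dots> = indicator {0..} t * emeasure (lborel_on ?S) (slack_polytope r ?S (z t))"
      by (rule nn_integral_cmult_indicator[OF sets_slack_polytope]) simp
    also have "\<dots> = ennreal (eval_mpoly (z t) ?v) * indicator {0..a l} t"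
      using IH(2)[of t] empty[of t] by (auto simp: indicator_def not_le)
    finally show "(\<integral>\<^sup>+ x. indicator (slack_polytope r (insert ?e ?S) a) (x(?e := t)) \<partial>lborel_on ?S)
        = ennreal (eval_mpoly (z t) ?v) * indicator {0..a l} t" .
  qed
  also have "\<dots> = ennreal (- eval_mpoly (z (a l)) ?w - (- eval_mpoly (z 0) ?w))"
    using der IH(1) al by (intro nn_integral_FTC_Icc meas) auto
  also have "\<dots> = ennreal (eval_mpoly a ?w)" by (simp add: end0 z0 del: vol_poly.simps)
  finally have "emeasure (lborel_on (insert ?e ?S)) (slack_polytope r (insert ?e ?S) a)
      = ennreal (eval_mpoly a ?w)" .
  moreover have "0 \<le> eval_mpoly a ?w"
  proof -
    have "- eval_mpoly (z 0) ?w \<le> - eval_mpoly (z (a l)) ?w"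
      using der IH(1) by (intro DERIV_nonneg_imp_nondecreasing[OF al]) blast
    then show ?thesis by (simp add: end0 z0 del: vol_poly.simps)
  qed
  ultimately show ?case by (simp del: vol_poly.simps)
qed

lemma closure_nice_chamber:
  assumes "x \<in> closure (nice_chamber r)"
  shows "x \<in> V_space r" "\<And>i. i \<in> {1..r} \<Longrightarrow> 0 \<le> x i"
proof -
  \<comment> \<open>The closure is taken among all functions with the product topology; the clause
    on \<open>undefined\<close> keeps limit points extensional, as \<open>V_space\<close>
    demands.\<close>
  let ?W = "{x :: nat \<Rightarrow> real. (\<forall>i\<in>{1..r}. 0 \<le> x i) \<and> (\<Sum>i=1..r+1. x i) = 0 \<and> (\<forall>i\<in>- {1..r+1}. x i = undefined)}"
  have "nice_chamber r \<subseteq> ?W"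
  proof
    fix x assume "x \<in> nice_chamber r"
    then obtain a where a: "x = V_vec r a" "\<forall>i\<in>{1..r}. 0 < a i" by (auto simp: nice_chamber_def)
    have "(\<Sum>i=1..r+1. x i) = 0" "\<forall>i\<in>- {1..r+1}. x i = undefined"
      using V_vec_in_V_space[of r a] unfolding a(1) V_space_def
      by (auto simp: PiE_iff extensional_def simp del: sum.cl_ivl_Suc)
    moreover have "\<forall>i\<in>{1..r}. 0 \<le> x i" using a by (auto simp: V_vec_simps intro: less_imp_le)
    ultimately show "x \<in> ?W" by blast
  qed
  moreover have "closed ?W"
    unfolding Collect_conj_eq Ball_def
    by (intro closed_Int closed_Collect_all closed_Collect_imp open_Collect_const closed_Collect_le closed_Collect_eq
        continuous_on_sum continuous_on_const continuous_on_product_coordinates)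
  ultimately have "closure (nice_chamber r) \<subseteq> ?W" by (rule closure_minimal)
  then have x: "x \<in> ?W" using assms by blast
  then show "\<And>i. i \<in> {1..r} \<Longrightarrow> 0 \<le> x i" by blast
  show "x \<in> V_space r"
    using x by (auto simp: V_space_def PiE_iff extensional_def simp del: sum.cl_ivl_Suc)
qed

lemma flow_volume_eq_eval:
  assumes pos: "\<And>i j. 1 \<le> i \<Longrightarrow> i < j \<Longrightarrow> j \<le> r + 1 \<Longrightarrow> 0 < m i j"
    and x: "x \<in> closure (nice_chamber r)"
  shows "flow_volume r m x = eval_mpoly x (vol_poly (free_coords r m))"
proof -
  have "i \<in> {1..r} \<and> i < j" if "(i, j, k) \<in> set (free_coords r m)" for i j k
    using that by (auto simp: set_free_coords flow_coords_def)
  note vol = emeasure_slack_polytope[OF distinct_free_coords sorted_free_coords this closure_nice_chamber(2)[OF x]]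
  show ?thesis
    using vol by (simp add: flow_volume_eq[OF pos closure_nice_chamber(1)[OF x]] measure_def)
qed

text \<open>Uniqueness holds because two candidates agree on the chamber, hence at all points of the
  positive orthant.\<close>

lemma nice_volume_poly_eq:
  assumes pos: "\<And>i j. 1 \<le> i \<Longrightarrow> i < j \<Longrightarrow> j \<le> r + 1 \<Longrightarrow> 0 < m i j"
  shows "nice_volume_poly r m = vol_poly (free_coords r m)"
  unfolding nice_volume_poly_def
proof (rule the_equality)
  let ?v = "vol_poly (free_coords r m)"
  have len: "length (free_coords r m) = num_coords r m - r"
    by (intro length_free_coords pos)
  have v: "homogeneous r (num_coords r m - r) ?v"
    using homogeneous_vol_poly[OF fst_free_coords, of r m] by (simp add: len)
  have ev: "\<forall>x\<in>closure (nice_chamber r). eval_mpoly x ?v = flow_volume r m x"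
    by (intro ballI flow_volume_eq_eval[symmetric] pos)
  show "homogeneous r (num_coords r m - r) ?v \<and>
      (\<forall>x\<in>closure (nice_chamber r). eval_mpoly x ?v = flow_volume r m x)"
    using v ev by blast
  fix p assume p: "homogeneous r (num_coords r m - r) p \<and>
      (\<forall>x\<in>closure (nice_chamber r). eval_mpoly x p = flow_volume r m x)"
  have "p - ?v = 0"
  proof (rule homogeneous_eq_0_if_eval_0)
    show hom: "homogeneous r (num_coords r m - r) (p - ?v)" using p v by (intro homogeneous_diff) auto
    fix x :: "nat \<Rightarrow> real" assume x: "\<And>i. i \<in> {1..r} \<Longrightarrow> 0 < x i"
    then have "V_vec r x \<in> closure (nice_chamber r)"
      by (intro closure_subset[THEN subsetD]) (auto simp: nice_chamber_def)
    then have "eval_mpoly (V_vec r x) (p - ?v) = 0" using p ev by (simp add: eval_mpoly_diff)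
    \<comment> \<open>The two points may differ outside \<open>{1..r}\<close>, but homogeneity
      confines the exponents to these variables.\<close>
    moreover have "V_vec r x i = x i"
      if "\<alpha> \<in> Poly_Mapping.keys (p - ?v)" "i \<in> Poly_Mapping.keys \<alpha>" for \<alpha> i
      using that hom V_vec_simps(1) unfolding homogeneous_def by blast
    then have "eval_mpoly (V_vec r x) (p - ?v) = eval_mpoly x (p - ?v)"
      unfolding eval_mpoly_def
      by (intro sum.cong prod.cong arg_cong2[where f = "(*)"] arg_cong2[where f = "(^)"] refl)
    ultimately show "eval_mpoly x (p - ?v) = 0" by simp
  qed
  then show "p = ?v" by simp
qed

theorem theorem3p4:
  fixes r d :: nat and m :: "nat \<Rightarrow> nat \<Rightarrow> nat"
  assumes "1 \<le> r"
    and "\<And>i j. 1 \<le> i \<Longrightarrow> i < j \<Longrightarrow> j \<le> r + 1 \<Longrightarrow> 0 < m i j"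
  shows "(num_coords r m - r < d \<longrightarrow>
           (\<forall>\<phi>. homogeneous r d \<phi> \<and> solves_flow_system r m \<phi> \<longrightarrow> \<phi> = 0)) \<and>
         (d \<le> num_coords r m - r \<longrightarrow>
           (\<exists>\<phi>. \<phi> \<noteq> 0 \<and> homogeneous r d \<phi> \<and> solves_flow_system r m \<phi>)) \<and>
         (d = num_coords r m - r \<longrightarrow>
           (\<forall>\<phi>. homogeneous r d \<phi> \<and> solves_flow_system r m \<phi> \<longrightarrow>
              (\<exists>c. \<phi> = const_mpoly c * nice_volume_poly r m)))"
proof (intro conjI impI allI)
  note pos = assms(2)
  fix \<phi>
  assume "num_coords r m - r < d" "homogeneous r d \<phi> \<and> solves_flow_system r m \<phi>"
  then show "\<phi> = 0" using solution_large_degree_eq_0[of r m, OF pos] by blast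
next
  assume "d \<le> num_coords r m - r"
  then show "\<exists>\<phi>. \<phi> \<noteq> 0 \<and> homogeneous r d \<phi> \<and> solves_flow_system r m \<phi>"
    by (intro exists_solution assms(2))
next
  note pos = assms(2)
  fix \<phi>
  assume d: "d = num_coords r m - r" and \<phi>: "homogeneous r d \<phi> \<and> solves_flow_system r m \<phi>"
  \<comment> \<open>The volume polynomial is itself the nonzero solution of top degree that
    \<open>top_solution_unique\<close> requires.\<close>
  let ?v = "vol_poly (free_coords r m)"
  have "homogeneous r (length (free_coords r m)) ?v"
    by (rule homogeneous_vol_poly[OF fst_free_coords])
  moreover have "length (free_coords r m) = num_coords r m - r"
    by (intro length_free_coords pos)
  ultimately have hom: "homogeneous r (num_coords r m - r) ?v" by simp
  have sol: "solves_flow_system r m ?v" by (intro solves_vol_poly pos)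
  have nz: "?v \<noteq> 0" by (rule vol_poly_nonzero[of _ r]) (auto simp: set_free_coords flow_coords_def)
  have eq: "nice_volume_poly r m = ?v" by (intro nice_volume_poly_eq pos)
  show "\<exists>c. \<phi> = const_mpoly c * nice_volume_poly r m"
    unfolding eq using \<phi> d by (intro top_solution_unique[OF pos _ _ hom sol nz]) auto
qed

end
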